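(* Let $\Omega$ be a bounded domain in $\mathbb{R}^m$. Let $H\in L^\infty(\Omega)$ be a real function, and let $\vec F=(F_1,\dots,F_m)\in W^{1,2}(\Omega)$ be a vector field satisfying $$ \operatorname{div}\vec F^{\,b}=\sum_{j,k=1}^m a^{jk}\,\partial_jF_k>0 \quad (\text{resp. } <0)\quad \text{a.e. in }\Omega, $$ where $a^{jk}$ are real constants such that $a^{jk}+a^{kj}=0$ for $1\le j,k\le m$. Let $u,v\in W^{1,2}(\Omega)$ be two minimizers for $\mathcal{F}_H$ such that $u-v\in W^{1,2}_0(\Omega)$. Then $u\equiv v$ in $\Omega$ (a.e.).
   Context: The generalized $p$-area is $\mathcal{F}_H(u) := \int_\Omega\{|\nabla u+\vec F|+Hu\}\,dx^1\wedge\cdots\wedge dx^m$. A function $u\in W^{1,2}(\Omega)$ is a minimizer for $\mathcal{F}_H$ if $\mathcal{F}_H(u)\le\mathcal{F}_H(u+\varphi)$ for every $\varphi\in W^{1,2}_0(\Omega)$. For a vector field $\vec G=(G_1,\dots,G_m)$, $\vec G^{\,b} := (\sum_k a^{1k}G_k,\dots,\sum_k a^{mk}G_k)$. The integer $m$ need not be even. *)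

theory Defs
  imports "HOL-Analysis.Analysis"
begin

definition partial_deriv :: "'m::finite \<Rightarrow> (real ^ 'm \<Rightarrow> real) \<Rightarrow> real ^ 'm \<Rightarrow> real" where
  "partial_deriv i f x = frechet_derivative f (at x) (axis i 1)"

primrec C_diff :: "nat \<Rightarrow> (real ^ 'm::finite \<Rightarrow> real) \<Rightarrow> bool" where
  "C_diff 0 f \<longleftrightarrow> continuous_on UNIV f"
| "C_diff (Suc k) f \<longleftrightarrow> (\<forall>x. f differentiable (at x)) \<and> (\<forall>i. C_diff k (partial_deriv i f))"

definition test_functions :: "(real ^ 'm::finite) set \<Rightarrow> (real ^ 'm \<Rightarrow> real) set" where
  "test_functions \<Omega> = {\<phi>. (\<forall>k. C_diff k \<phi>) \<and>
     compact (closure {x. \<phi> x \<noteq> 0}) \<and> closure {x. \<phi> x \<noteq> 0} \<subseteq> \<Omega>}"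

text \<open>
  Functions on \<open>\<Omega>\<close> are represented by total functions whose values outside \<open>\<Omega>\<close> are irrelevant,
  and elements of Lebesgue and Sobolev spaces by representatives rather than by
  equivalence classes modulo null sets.
\<close>

definition locally_integrable :: "(real ^ 'm::finite) set \<Rightarrow> (real ^ 'm \<Rightarrow> real) \<Rightarrow> bool" where
  "locally_integrable \<Omega> f \<longleftrightarrow> (\<forall>K. compact K \<and> K \<subseteq> \<Omega> \<longrightarrow> set_integrable lebesgue K f)"

definition L2 :: "(real ^ 'm::finite) set \<Rightarrow> (real ^ 'm \<Rightarrow> real) set" where
  "L2 \<Omega> = {f \<in> borel_measurable (lebesgue_on \<Omega>). integrable (lebesgue_on \<Omega>) (\<lambda>x. (f x)\<^sup>2)}"

definition Linfty :: "(real ^ 'm::finite) set \<Rightarrow> (real ^ 'm \<Rightarrow> real) set" where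
  "Linfty \<Omega> = {f \<in> borel_measurable (lebesgue_on \<Omega>).
     \<exists>C. AE x in lebesgue_on \<Omega>. \<bar>f x\<bar> \<le> C}"

definition has_weak_partial ::
    "(real ^ 'm::finite) set \<Rightarrow> 'm \<Rightarrow> (real ^ 'm \<Rightarrow> real) \<Rightarrow> (real ^ 'm \<Rightarrow> real) \<Rightarrow> bool" where
  "has_weak_partial \<Omega> i u g \<longleftrightarrow> locally_integrable \<Omega> u \<and> locally_integrable \<Omega> g \<and>
     (\<forall>\<phi> \<in> test_functions \<Omega>.
        (LINT x|lebesgue_on \<Omega>. u x * partial_deriv i \<phi> x) = - (LINT x|lebesgue_on \<Omega>. g x * \<phi> x))"

text \<open>
  A weak partial derivative on an open set is unique up to a null set, so all notions below
  are independent of the choice made by \<open>SOME\<close>.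
\<close>

definition weak_partial ::
    "(real ^ 'm::finite) set \<Rightarrow> 'm \<Rightarrow> (real ^ 'm \<Rightarrow> real) \<Rightarrow> real ^ 'm \<Rightarrow> real" where
  "weak_partial \<Omega> i u = (SOME g. has_weak_partial \<Omega> i u g)"

definition weak_grad ::
    "(real ^ 'm::finite) set \<Rightarrow> (real ^ 'm \<Rightarrow> real) \<Rightarrow> real ^ 'm \<Rightarrow> real ^ 'm" where
  "weak_grad \<Omega> u x = (\<chi> i. weak_partial \<Omega> i u x)"

definition weak_div ::
    "(real ^ 'm::finite) set \<Rightarrow> (real ^ 'm \<Rightarrow> real ^ 'm) \<Rightarrow> real ^ 'm \<Rightarrow> real" where
  "weak_div \<Omega> G x = (\<Sum>j\<in>UNIV. weak_partial \<Omega> j (\<lambda>y. G y $ j) x)"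

definition W12 :: "(real ^ 'm::finite) set \<Rightarrow> (real ^ 'm \<Rightarrow> real) set" where
  "W12 \<Omega> = {u \<in> L2 \<Omega>. \<forall>i. \<exists>g \<in> L2 \<Omega>. has_weak_partial \<Omega> i u g}"

definition W12_norm :: "(real ^ 'm::finite) set \<Rightarrow> (real ^ 'm \<Rightarrow> real) \<Rightarrow> real" where
  "W12_norm \<Omega> u = sqrt ((LINT x|lebesgue_on \<Omega>. (u x)\<^sup>2) +
     (LINT x|lebesgue_on \<Omega>. (norm (weak_grad \<Omega> u x))\<^sup>2))"

definition W12_0 :: "(real ^ 'm::finite) set \<Rightarrow> (real ^ 'm \<Rightarrow> real) set" where
  "W12_0 \<Omega> = {u \<in> W12 \<Omega>. \<exists>\<phi>. (\<forall>n::nat. \<phi> n \<in> test_functions \<Omega>) \<and>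
     (\<lambda>n. W12_norm \<Omega> (\<lambda>x. u x - \<phi> n x)) \<longlonglongrightarrow> 0}"

definition p_area ::
    "(real ^ 'm::finite) set \<Rightarrow> (real ^ 'm \<Rightarrow> real ^ 'm) \<Rightarrow> (real ^ 'm \<Rightarrow> real) \<Rightarrow> (real ^ 'm \<Rightarrow> real) \<Rightarrow> real" where
  "p_area \<Omega> F H u = (LINT x|lebesgue_on \<Omega>. norm (weak_grad \<Omega> u x + F x) + H x * u x)"

definition p_area_minimizer ::
    "(real ^ 'm::finite) set \<Rightarrow> (real ^ 'm \<Rightarrow> real ^ 'm) \<Rightarrow> (real ^ 'm \<Rightarrow> real) \<Rightarrow> (real ^ 'm \<Rightarrow> real) \<Rightarrow> bool" where
  "p_area_minimizer \<Omega> F H u \<longleftrightarrow> u \<in> W12 \<Omega> \<and>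
     (\<forall>\<phi> \<in> W12_0 \<Omega>. p_area \<Omega> F H u \<le> p_area \<Omega> F H (\<lambda>x. u x + \<phi> x))"

definition flat :: "real ^ 'm::finite ^ 'm \<Rightarrow> (real ^ 'm \<Rightarrow> real ^ 'm) \<Rightarrow> real ^ 'm \<Rightarrow> real ^ 'm" where
  "flat a G x = a *v G x"

end

theory Submission
  imports Defs
begin

text \<open>
Let \<open>w = u - v\<close> and write \<open>A = \<nabla>u + F\<close> and \<open>B = \<nabla>v + F\<close>.

The functional is convex and \<open>(u + v) / 2\<close> is a competitor for both minimizers, so the triangle inequality
\<open>|A + B| \<le> |A| + |B|\<close> must be an equality almost everywhere (\<open>minimizers_norm_add\<close>). Then \<open>A\<close> and \<open>B\<close> are
parallel. Since the matrix \<open>a\<close> is skew, \<open>a A\<close> is orthogonal to \<open>A\<close> and to \<open>B\<close>, hence to \<open>\<nabla>w = A - B\<close>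
(\<open>norm_add_eq_imp_skew_orthogonal\<close>). This includes the singular points, where \<open>A\<close> or \<open>B\<close>
vanishes.

On the other hand, \<open>a A = a \<nabla>u + a F\<close> has the same divergence as \<open>a F\<close>, because a rotated gradient
is divergence free in the weak sense: second derivatives commute (\<open>skew_gradient_divergence_free\<close>). Testing
\<open>div (a A) = div (a F)\<close> with \<open>G(w)\<close>, where \<open>G(t) = t\<^sup>2 / (1 + t\<^sup>2)\<close>, gives
\<open>\<integral> G(w) div (a F) = - \<integral> G'(w) \<nabla>w \<bullet> a A = 0\<close> (\<open>integral_saturation_eq_0\<close>). As \<open>div (a F)\<close> has a strict sign
and \<open>G(w) \<ge> 0\<close>, it follows that \<open>G(w) = 0\<close> and so \<open>w = 0\<close> almost everywhere. The function \<open>G\<close>, called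
\<open>saturation\<close> below, has a bounded derivative, which makes the passage from test functions to \<open>w\<close> a matter of the
Cauchy-Schwarz inequality alone.

The remaining work is the theory of weak derivatives that this uses: integration by parts for smooth functions
(\<open>smooth_has_weak_partial\<close>), and uniqueness of weak derivatives (\<open>has_weak_partial_unique\<close>), which
rests on the fundamental lemma of the calculus of variations (\<open>fundamental_lemma\<close>). Uniqueness is what makes
the weak gradient linear up to null sets, since \<^const>\<open>weak_partial\<close> is an arbitrary choice.
\<close>

section \<open>Calculus of smooth functions\<close>

lemma partial_deriv_eqI:
  assumes "(f has_derivative D) (at x)"
  shows "partial_deriv i f x = D (axis i 1)"
  using frechet_derivative_at[OF assms] by (simp add: partial_deriv_def)

lemma partial_deriv_chain:
  fixes f :: "real ^ 'm::finite \<Rightarrow> real"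
  assumes "f differentiable (at x)" and "(g has_real_derivative d) (at (f x))"
  shows "(\<lambda>x. g (f x)) differentiable (at x)"
    and "partial_deriv i (\<lambda>x. g (f x)) x = d * partial_deriv i f x"
proof -
  have 1: "(f has_derivative frechet_derivative f (at x)) (at x)"
    using assms(1) frechet_derivative_works by blast
  have 2: "(g has_derivative (*) d) (at (f x))"
    using assms(2) by (simp add: has_field_derivative_def)
  have 3: "((\<lambda>x. g (f x)) has_derivative (\<lambda>h. d * frechet_derivative f (at x) h)) (at x)"
    using has_derivative_compose[OF 1 2] by simp
  show "(\<lambda>x. g (f x)) differentiable (at x)"
    using 3 by (auto simp: differentiable_def)
  show "partial_deriv i (\<lambda>x. g (f x)) x = d * partial_deriv i f x"
    using partial_deriv_eqI[OF 3] by (simp add: partial_deriv_def)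
qed

lemma partial_deriv_add:
  assumes "f differentiable (at x)" "g differentiable (at x)"
  shows "partial_deriv i (\<lambda>x. f x + g x) x = partial_deriv i f x + partial_deriv i g x"
proof -
  have "((\<lambda>x. f x + g x) has_derivative
      (\<lambda>h. frechet_derivative f (at x) h + frechet_derivative g (at x) h)) (at x)"
    using assms frechet_derivative_works by (intro has_derivative_add) blast+
  from partial_deriv_eqI[OF this] show ?thesis by (simp add: partial_deriv_def)
qed

lemma partial_deriv_mult:
  assumes "f differentiable (at x)" "g differentiable (at x)"
  shows "partial_deriv i (\<lambda>x. f x * g x) x = f x * partial_deriv i g x + partial_deriv i f x * g x"
proof -
  have "((\<lambda>x. f x * g x) has_derivative
      (\<lambda>h. f x * frechet_derivative g (at x) h + frechet_derivative f (at x) h * g x)) (at x)"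
    using assms frechet_derivative_works by (intro has_derivative_mult) blast+
  from partial_deriv_eqI[OF this] show ?thesis by (simp add: partial_deriv_def)
qed

lemma partial_deriv_const [simp]: "partial_deriv i (\<lambda>x. c) = (\<lambda>x. 0)"
  by (rule ext) (simp add: partial_deriv_def frechet_derivative_const)

lemma partial_deriv_affine_coord:
  "partial_deriv i (\<lambda>x. s * (x $ j - c)) x = (if i = j then s else 0)"
proof -
  have "((\<lambda>x. s * (x $ j - c)) has_derivative (\<lambda>h. s * (h $ j))) (at x)"
    by (auto intro!: derivative_eq_intros bounded_linear_imp_has_derivative bounded_linear_vec_nth)
  from partial_deriv_eqI[OF this] show ?thesis by (auto simp: axis_def)
qed

lemma C_diff_Suc_imp: "C_diff (Suc k) f \<Longrightarrow> C_diff k f"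
proof (induction k arbitrary: f)
  case 0
  then show ?case
    by (auto intro!: continuous_at_imp_continuous_on differentiable_imp_continuous_within)
next
  case (Suc k)
  have "C_diff k (partial_deriv i f)" for i
    using Suc.prems by (intro Suc.IH) simp
  moreover have "f differentiable (at x)" for x
    using Suc.prems by simp
  ultimately show ?case by simp
qed

lemma C_diff_const: "C_diff k (\<lambda>x. c)"
  by (induction k arbitrary: c) auto

lemma C_diff_add: "C_diff k f \<Longrightarrow> C_diff k g \<Longrightarrow> C_diff k (\<lambda>x. f x + g x)"
proof (induction k arbitrary: f g)
  case 0
  then show ?case by (auto intro: continuous_intros)
next
  case (Suc k)
  then have "partial_deriv i (\<lambda>x. f x + g x) = (\<lambda>x. partial_deriv i f x + partial_deriv i g x)" for i
    by (intro ext partial_deriv_add) auto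
  then show ?case using Suc by auto
qed

lemma C_diff_mult: "C_diff k f \<Longrightarrow> C_diff k g \<Longrightarrow> C_diff k (\<lambda>x. f x * g x)"
proof (induction k arbitrary: f g)
  case 0
  then show ?case by (auto intro: continuous_intros)
next
  case (Suc k)
  then have "partial_deriv i (\<lambda>x. f x * g x) = (\<lambda>x. f x * partial_deriv i g x + partial_deriv i f x * g x)" for i
    by (intro ext partial_deriv_mult) auto
  moreover have "C_diff k (\<lambda>x. f x * partial_deriv i g x + partial_deriv i f x * g x)" for i
    using Suc.prems by (intro C_diff_add Suc.IH C_diff_Suc_imp[of k f] C_diff_Suc_imp[of k g]) auto
  ultimately show ?case using Suc.prems by auto
qed

lemma C_diff_prod:
  "finite I \<Longrightarrow> (\<And>j. j \<in> I \<Longrightarrow> C_diff k (f j)) \<Longrightarrow> C_diff k (\<lambda>x. \<Prod>j\<in>I. f j x)"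
  by (induction I rule: finite_induct) (auto intro: C_diff_const C_diff_mult)

text \<open>
The derivative of \<open>h = 1 / (1 + f\<^sup>2)\<close> is \<open>- 2 f h\<^sup>2 \<partial>f\<close>, which again involves \<open>h\<close> only through products.
So closure under products carries the induction on the order of differentiability.
\<close>

lemma C_diff_inverse_1_plus_square:
  assumes "\<And>k. C_diff k f"
  shows "C_diff k (\<lambda>x. inverse (1 + (f x)\<^sup>2))"
proof (induction k)
  case 0
  have "continuous_on UNIV f" using assms[of 0] by simp
  then show ?case by (auto intro!: continuous_intros simp: add_nonneg_eq_0_iff)
next
  case (Suc k)
  let ?h = "\<lambda>x. inverse (1 + (f x)\<^sup>2)"
  have f: "f differentiable (at x)" for x
    using assms[of "Suc 0"] by simp
  have D: "((\<lambda>t. inverse (1 + t\<^sup>2)) has_real_derivative (- 2 * t * (inverse (1 + t\<^sup>2))\<^sup>2)) (at t)" for t :: real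
    by (auto intro!: derivative_eq_intros simp: add_nonneg_eq_0_iff power2_eq_square)
  have "partial_deriv i ?h = (\<lambda>x. ((- 2) * f x) * (?h x * ?h x) * partial_deriv i f x)" for i
    using partial_deriv_chain(2)[OF f D] by (simp add: power2_eq_square fun_eq_iff)
  moreover have "C_diff k (partial_deriv i f)" for i
    using assms[of "Suc k"] by simp
  then have "C_diff k (\<lambda>x. ((- 2) * f x) * (?h x * ?h x) * partial_deriv i f x)" for i
    by (intro C_diff_mult C_diff_const Suc.IH assms)
  ultimately show ?case using partial_deriv_chain(1)[OF f D] by auto
qed

section \<open>Flat exponentials\<close>

text \<open>
These are the functions \<open>exp (- 1 / t) / t ^ p\<close>, extended by \<open>0\<close> to \<open>t \<le> 0\<close>. The negative power is there
because the family is then closed under differentiation up to linear combinations; this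
proves that \<open>exp (- 1 / t)\<close> is smooth at \<open>0\<close> by a single induction.
\<close>

definition flat_exp :: "nat \<Rightarrow> real \<Rightarrow> real" where
  "flat_exp p t = (if t > 0 then exp (- inverse t) * (inverse t) ^ p else 0)"

text \<open>
The exponential series dominates its term of order \<open>p + 1\<close>. The bound gives continuity at \<open>0\<close>
and, since \<open>flat_exp p t / t = flat_exp (p + 1) t\<close>, also differentiability there.
\<close>

lemma flat_exp_le: "flat_exp p t \<le> fact (Suc p) * \<bar>t\<bar>"
proof (cases "t > 0")
  case True
  define s where "s = inverse t"
  have s: "s > 0" using True s_def by simp
  have "s ^ Suc p / fact (Suc p) \<le> exp s"
  proof -
    have "(\<Sum>n\<in>{Suc p}. s ^ n /\<^sub>R fact n) \<le> (\<Sum>n. s ^ n /\<^sub>R fact n)"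
      using s by (intro sum_le_suminf summable_exp_generic) auto
    then show ?thesis by (simp add: exp_def divide_inverse mult.commute)
  qed
  then have "s ^ Suc p * exp (-s) \<le> fact (Suc p)"
    using fact_gt_zero[of "Suc p", where ?'a=real]
    by (simp add: exp_minus field_simps del: fact_Suc power_Suc)
  then have "t * (s ^ Suc p * exp (-s)) \<le> t * fact (Suc p)"
    using True by (intro mult_left_mono) auto
  moreover have "t * (s ^ Suc p * exp (-s)) = exp (-s) * s ^ p"
    using True by (simp add: s_def)
  ultimately have "exp (-s) * s ^ p \<le> fact (Suc p) * t"
    by (metis mult.commute)
  then show ?thesis using True by (simp add: flat_exp_def s_def)
qed (use fact_ge_zero in \<open>simp add: flat_exp_def mult_nonneg_nonpos del: fact_Suc\<close>)

lemma flat_exp_nonneg: "0 \<le> flat_exp p t"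
  by (simp add: flat_exp_def)

lemma flat_exp_has_derivative:
  "(flat_exp p has_real_derivative flat_exp (Suc (Suc p)) t - p * flat_exp (Suc p) t) (at t)"
proof -
  consider "t > 0" | "t < 0" | "t = 0" by linarith
  then show ?thesis
  proof cases
    case 1
    let ?d = "exp (- inverse t) * (inverse t)\<^sup>2 * inverse t ^ p
        - exp (- inverse t) * (p * inverse t ^ (p - 1) * (inverse t)\<^sup>2)"
    have "((\<lambda>t. exp (- inverse t) * (inverse t) ^ p) has_real_derivative ?d) (at t)"
      using 1 by (auto intro!: derivative_eq_intros simp: power2_eq_square)
    moreover have "?d = flat_exp (Suc (Suc p)) t - p * flat_exp (Suc p) t"
      using 1 by (cases p) (auto simp: flat_exp_def power2_eq_square mult_ac)
    ultimately have "((\<lambda>t. exp (- inverse t) * (inverse t) ^ p) has_real_derivative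
        flat_exp (Suc (Suc p)) t - p * flat_exp (Suc p) t) (at t)"
      by simp
    then show ?thesis
      by (rule has_field_derivative_transform_within_open[of _ _ _ "{0<..}"]) (use 1 in \<open>auto simp: flat_exp_def\<close>)
  next
    case 2
    have "((\<lambda>t. 0) has_real_derivative flat_exp (Suc (Suc p)) t - p * flat_exp (Suc p) t) (at t)"
      using 2 by (auto simp: flat_exp_def)
    then show ?thesis
      by (rule has_field_derivative_transform_within_open[of _ _ _ "{..<0}"]) (use 2 in \<open>auto simp: flat_exp_def\<close>)
  next
    case 3
    have *: "flat_exp p h / h = flat_exp (Suc p) h" for h
      by (auto simp: flat_exp_def field_simps)
    have "((\<lambda>h. fact (Suc (Suc p)) * \<bar>h\<bar>) \<longlongrightarrow> fact (Suc (Suc p)) * \<bar>0::real\<bar>) (at 0)"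
      by (intro tendsto_intros)
    then have "(flat_exp (Suc p) \<longlongrightarrow> 0) (at 0)"
      by (intro tendsto_sandwich[of "\<lambda>_. 0" "flat_exp (Suc p)" "at 0" "\<lambda>h. fact (Suc (Suc p)) * \<bar>h\<bar>" 0])
         (auto simp: flat_exp_nonneg simp del: fact_Suc intro!: always_eventually flat_exp_le)
    then have "((\<lambda>h. (flat_exp p (0 + h) - flat_exp p 0) / h) \<longlongrightarrow> 0) (at 0)"
      using * by (simp add: flat_exp_def[of p 0])
    then show ?thesis
      using 3 by (simp add: DERIV_def flat_exp_def[of _ 0])
  qed
qed

lemma C_diff_flat_exp_coord: "C_diff k (\<lambda>x. flat_exp p (s * (x $ j - c)))"
proof (induction k arbitrary: p)
  case 0
  have "continuous_on UNIV (flat_exp p)"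
    using flat_exp_has_derivative[THEN DERIV_isCont] by (auto intro: continuous_at_imp_continuous_on)
  then show ?case
    by (auto intro!: continuous_on_compose2[of UNIV "flat_exp p"] continuous_intros)
next
  case (Suc k)
  have d: "(\<lambda>x. s * (x $ j - c)) differentiable (at x)" for x
    by (auto simp: differentiable_def intro!: derivative_eq_intros bounded_linear_imp_has_derivative bounded_linear_vec_nth exI)
  have "partial_deriv i (\<lambda>x. flat_exp p (s * (x $ j - c))) =
     (\<lambda>x. (flat_exp (Suc (Suc p)) (s * (x $ j - c)) + (- real p) * flat_exp (Suc p) (s * (x $ j - c))) * (if i = j then s else 0))" for i
    by (rule ext) (simp add: partial_deriv_chain(2)[OF d flat_exp_has_derivative] partial_deriv_affine_coord)
  moreover have "C_diff k (\<lambda>x. (flat_exp (Suc (Suc p)) (s * (x $ j - c)) + (- real p) * flat_exp (Suc p) (s * (x $ j - c))) * (if i = j then s else 0))" for i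
    by (intro C_diff_mult C_diff_const C_diff_add Suc)
  ultimately show ?case
    using partial_deriv_chain(1)[OF d flat_exp_has_derivative] by auto
qed

section \<open>Symmetry of second derivatives\<close>

lemma DERIV_along_axis:
  fixes f :: "real ^ 'm::finite \<Rightarrow> real"
  assumes "\<And>x. f differentiable (at x)"
  shows "((\<lambda>s. f (y + s *\<^sub>R axis i 1)) has_real_derivative partial_deriv i f (y + t *\<^sub>R axis i 1)) (at t)"
proof -
  let ?z = "y + t *\<^sub>R axis i 1"
  have 1: "(f has_derivative frechet_derivative f (at ?z)) (at ?z)"
    using assms frechet_derivative_works by blast
  have 2: "((\<lambda>s. y + s *\<^sub>R axis i 1) has_derivative (\<lambda>h. h *\<^sub>R axis i 1)) (at t)"
    by (auto intro!: derivative_eq_intros)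
  have "((\<lambda>s. f (y + s *\<^sub>R axis i 1)) has_derivative
      (\<lambda>h. frechet_derivative f (at ?z) (h *\<^sub>R axis i 1))) (at t)"
    using has_derivative_compose[OF 2 1] .
  moreover have "frechet_derivative f (at ?z) (h *\<^sub>R axis i 1) = partial_deriv i f ?z * h" for h
    using has_derivative_linear[OF 1] by (simp add: linear_cmul partial_deriv_def)
  ultimately show ?thesis by (simp add: has_field_derivative_def fun_eq_iff)
qed

text \<open>
The mean value theorem, applied first in direction \<open>i\<close> and then in direction \<open>j\<close>. The double
difference on the left is symmetric in \<open>i\<close> and \<open>j\<close>, whence the symmetry of the mixed derivatives.
\<close>

lemma double_difference_mean_value:
  fixes f :: "real ^ 'm::finite \<Rightarrow> real"
  assumes f: "\<And>x. f differentiable (at x)" and fi: "\<And>x. partial_deriv i f differentiable (at x)"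
    and "s > 0"
  shows "\<exists>p q. 0 < p \<and> p < s \<and> 0 < q \<and> q < s \<and>
     f (x + s *\<^sub>R axis i 1 + s *\<^sub>R axis j 1) - f (x + s *\<^sub>R axis i 1) - f (x + s *\<^sub>R axis j 1) + f x
     = s * s * partial_deriv j (partial_deriv i f) (x + p *\<^sub>R axis i 1 + q *\<^sub>R axis j 1)"
proof -
  \<comment> \<open>Difference in direction \<open>j\<close>, as a function of the displacement \<open>r\<close> in direction \<open>i\<close>.\<close>
  define g where "g r = f (x + s *\<^sub>R axis j 1 + r *\<^sub>R axis i 1) - f (x + r *\<^sub>R axis i 1)" for r
  have "(g has_real_derivative (partial_deriv i f (x + s *\<^sub>R axis j 1 + r *\<^sub>R axis i 1)
      - partial_deriv i f (x + r *\<^sub>R axis i 1))) (at r)" for r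
    unfolding g_def by (intro DERIV_diff DERIV_along_axis f)
  from MVT2[OF \<open>s > 0\<close> this] obtain p where p: "0 < p" "p < s"
    "g s - g 0 = s * (partial_deriv i f (x + s *\<^sub>R axis j 1 + p *\<^sub>R axis i 1)
      - partial_deriv i f (x + p *\<^sub>R axis i 1))" by auto
  from MVT2[OF \<open>s > 0\<close> DERIV_along_axis[OF fi, of "x + p *\<^sub>R axis i 1" j]] obtain q where q: "0 < q" "q < s"
    "partial_deriv i f (x + p *\<^sub>R axis i 1 + s *\<^sub>R axis j 1) - partial_deriv i f (x + p *\<^sub>R axis i 1)
     = s * partial_deriv j (partial_deriv i f) (x + p *\<^sub>R axis i 1 + q *\<^sub>R axis j 1)" by auto
  have "g s - g 0 = s * s * partial_deriv j (partial_deriv i f) (x + p *\<^sub>R axis i 1 + q *\<^sub>R axis j 1)"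
    using p(3) q(3) by (simp add: add_ac)
  then show ?thesis using p q by (intro exI[of _ p] exI[of _ q]) (simp add: g_def add_ac)
qed

lemma partial_deriv_commute:
  fixes f :: "real ^ 'm::finite \<Rightarrow> real"
  assumes f: "C_diff 2 f"
  shows "partial_deriv j (partial_deriv i f) x = partial_deriv i (partial_deriv j f) x"
proof -
  have f1: "\<And>x. f differentiable (at x)" "\<And>i x. partial_deriv i f differentiable (at x)"
    and f2: "\<And>i j. continuous_on UNIV (partial_deriv j (partial_deriv i f))"
    using f by (auto simp: numeral_2_eq_2)
  define s :: "nat \<Rightarrow> real" where "s n = inverse (Suc n)" for n
  have s: "s n > 0" "s \<longlonglongrightarrow> 0" for n
    unfolding s_def using LIMSEQ_inverse_real_of_nat by auto
  define D where "D i j n = f (x + s n *\<^sub>R axis i 1 + s n *\<^sub>R axis j 1) - f (x + s n *\<^sub>R axis i 1)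
     - f (x + s n *\<^sub>R axis j 1) + f x" for i j n
  have lim: "(\<lambda>n. D i j n / (s n * s n)) \<longlonglongrightarrow> partial_deriv j (partial_deriv i f) x" for i j
  proof -
    have "\<exists>p q. 0 < p \<and> p < s n \<and> 0 < q \<and> q < s n \<and>
      D i j n = s n * s n * partial_deriv j (partial_deriv i f) (x + p *\<^sub>R axis i 1 + q *\<^sub>R axis j 1)" for n
      unfolding D_def by (rule double_difference_mean_value[OF f1(1) f1(2) s(1)])
    then obtain p q where pq: "\<And>n. 0 < p n \<and> p n < s n \<and> 0 < q n \<and> q n < s n \<and>
      D i j n = s n * s n * partial_deriv j (partial_deriv i f) (x + p n *\<^sub>R axis i 1 + q n *\<^sub>R axis j 1)"
      by metis
    have "p \<longlonglongrightarrow> 0" "q \<longlonglongrightarrow> 0"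
      by (rule tendsto_sandwich[OF _ _ tendsto_const s(2)]; use pq in \<open>auto intro!: always_eventually less_imp_le\<close>)+
    then have "(\<lambda>n. x + p n *\<^sub>R axis i 1 + q n *\<^sub>R axis j 1) \<longlonglongrightarrow> x + 0 *\<^sub>R axis i 1 + 0 *\<^sub>R axis j 1"
      by (intro tendsto_intros)
    moreover have "isCont (partial_deriv j (partial_deriv i f)) x"
      using f2 by (simp add: continuous_on_eq_continuous_at)
    ultimately have "(\<lambda>n. partial_deriv j (partial_deriv i f) (x + p n *\<^sub>R axis i 1 + q n *\<^sub>R axis j 1))
      \<longlonglongrightarrow> partial_deriv j (partial_deriv i f) x"
      using isCont_tendsto_compose by fastforce
    moreover have "D i j n / (s n * s n) = partial_deriv j (partial_deriv i f) (x + p n *\<^sub>R axis i 1 + q n *\<^sub>R axis j 1)" for n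
      using pq[of n] s(1)[of n] by auto
    ultimately show ?thesis by simp
  qed
  have "D i j = D j i" by (auto simp: D_def add_ac fun_eq_iff)
  then show ?thesis using LIMSEQ_unique lim[of i j] lim[of j i] by metis
qed

section \<open>Test functions and integration by parts\<close>

lemma test_functions_continuous: "\<phi> \<in> test_functions \<Omega> \<Longrightarrow> continuous_on UNIV \<phi>"
  by (auto simp: test_functions_def dest: spec[of _ 0])

lemma test_functions_C_diff: "\<phi> \<in> test_functions \<Omega> \<Longrightarrow> C_diff k \<phi>"
  by (simp add: test_functions_def)

lemma test_functions_differentiable: "\<phi> \<in> test_functions \<Omega> \<Longrightarrow> \<phi> differentiable (at x)"
  using test_functions_C_diff[of \<phi> \<Omega> "Suc 0"] by simp

lemma test_functions_smaller_support:
  assumes "\<phi> \<in> test_functions \<Omega>" and "\<And>k. C_diff k \<psi>"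
    and "{x. \<psi> x \<noteq> 0} \<subseteq> closure {x. \<phi> x \<noteq> 0}"
  shows "\<psi> \<in> test_functions \<Omega>"
proof -
  have sub: "closure {x. \<psi> x \<noteq> 0} \<subseteq> closure {x. \<phi> x \<noteq> 0}"
    using assms(3) closure_minimal by blast
  moreover have "compact (closure {x. \<psi> x \<noteq> 0})"
    using compact_Int_closed[of "closure {x. \<phi> x \<noteq> 0}" "closure {x. \<psi> x \<noteq> 0}"] assms(1) sub
    by (simp add: test_functions_def Int_absorb1)
  ultimately show ?thesis using assms(1,2) by (auto simp: test_functions_def)
qed

lemma test_functions_partial_deriv:
  assumes "\<phi> \<in> test_functions \<Omega>"
  shows "partial_deriv i \<phi> \<in> test_functions \<Omega>"
proof (rule test_functions_smaller_support[OF assms])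
  show "C_diff k (partial_deriv i \<phi>)" for k
    using test_functions_C_diff[OF assms, of "Suc k"] by simp
  show "{x. partial_deriv i \<phi> x \<noteq> 0} \<subseteq> closure {x. \<phi> x \<noteq> 0}"
  proof (rule subsetI, rule ccontr)
    fix x assume x: "x \<in> {x. partial_deriv i \<phi> x \<noteq> 0}" "x \<notin> closure {x. \<phi> x \<noteq> 0}"
    have "(\<phi> has_derivative (\<lambda>h. 0)) (at x)"
    proof (rule has_derivative_transform_within_open)
      show "((\<lambda>x. 0) has_derivative (\<lambda>h. 0)) (at x)" by simp
      show "open (- closure {x. \<phi> x \<noteq> 0})" by auto
      show "x \<in> - closure {x. \<phi> x \<noteq> 0}" using x by auto
      show "0 = \<phi> y" if "y \<in> - closure {x. \<phi> x \<noteq> 0}" for y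
        using that closure_subset[of "{x. \<phi> x \<noteq> 0}"] by auto
    qed
    from partial_deriv_eqI[OF this] x show False by simp
  qed
qed

lemma test_functions_mult:
  assumes "\<phi> \<in> test_functions \<Omega>" and "\<And>k. C_diff k f"
  shows "(\<lambda>x. f x * \<phi> x) \<in> test_functions \<Omega>"
proof (rule test_functions_smaller_support[OF assms(1)])
  show "C_diff k (\<lambda>x. f x * \<phi> x)" for k
    by (intro C_diff_mult assms(2) test_functions_C_diff[OF assms(1)])
  show "{x. f x * \<phi> x \<noteq> 0} \<subseteq> closure {x. \<phi> x \<noteq> 0}"
    using closure_subset[of "{x. \<phi> x \<noteq> 0}"] by auto
qed

lemma test_functions_bounded:
  assumes "\<phi> \<in> test_functions \<Omega>"
  obtains B where "\<And>x. \<bar>\<phi> x\<bar> \<le> B"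
proof -
  let ?K = "closure {x. \<phi> x \<noteq> 0}"
  have "compact (\<phi> ` ?K)"
    using assms test_functions_continuous[OF assms]
    by (intro compact_continuous_image) (auto simp: test_functions_def intro: continuous_on_subset)
  then obtain B where B: "\<And>x. x \<in> ?K \<Longrightarrow> \<bar>\<phi> x\<bar> \<le> B"
    using compact_imp_bounded bounded_iff by (metis imageI real_norm_def)
  have "\<bar>\<phi> x\<bar> \<le> max B 0" for x
    using B[of x] closure_subset[of "{x. \<phi> x \<noteq> 0}"] by (cases "\<phi> x = 0") force+
  then show ?thesis using that by blast
qed

lemma test_functions_eq_0:
  assumes "\<phi> \<in> test_functions \<Omega>" "x \<notin> \<Omega>"
  shows "\<phi> x = 0"
  using assms closure_subset[of "{x. \<phi> x \<noteq> 0}"] by (auto simp: test_functions_def)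

lemma test_functions_borel_measurable: "\<phi> \<in> test_functions \<Omega> \<Longrightarrow> \<phi> \<in> borel_measurable borel"
  by (intro borel_measurable_continuous_onI test_functions_continuous)

lemma continuous_borel_measurable_lebesgue_on:
  "continuous_on UNIV f \<Longrightarrow> f \<in> borel_measurable (lebesgue_on \<Omega>)"
  by (intro measurable_restrict_space1 measurable_completion)
     (simp add: borel_measurable_continuous_onI)

lemma continuous_imp_locally_integrable:
  fixes f :: "real ^ 'm::finite \<Rightarrow> real"
  assumes "continuous_on UNIV f"
  shows "locally_integrable \<Omega> f"
  unfolding locally_integrable_def set_integrable_def
proof (intro allI impI)
  fix K :: "(real ^ 'm) set" assume K: "compact K \<and> K \<subseteq> \<Omega>"
  have "integrable lborel (\<lambda>x. indicator K x *\<^sub>R f x)"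
    using K assms by (intro borel_integrable_compact) (auto intro: continuous_on_subset)
  then show "integrable lebesgue (\<lambda>x. indicator K x *\<^sub>R f x)"
    by (metis integrable_completion borel_measurable_integrable measurable_lborel1)
qed

lemma locally_integrable_times_test:
  fixes g :: "real ^ 'm::finite \<Rightarrow> real"
  assumes "open \<Omega>" "locally_integrable \<Omega> g" and \<phi>: "\<phi> \<in> test_functions \<Omega>"
  shows "integrable (lebesgue_on \<Omega>) (\<lambda>x. g x * \<phi> x)"
proof -
  let ?K = "closure {x. \<phi> x \<noteq> 0}"
  obtain B where B: "\<And>x. \<bar>\<phi> x\<bar> \<le> B" using test_functions_bounded[OF \<phi>] by blast
  have g: "integrable lebesgue (\<lambda>x. indicator ?K x *\<^sub>R g x)"
    using assms by (auto simp: locally_integrable_def test_functions_def set_integrable_def)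
  have "integrable lebesgue (\<lambda>x. \<phi> x * (indicator ?K x *\<^sub>R g x))"
  proof (rule Bochner_Integration.integrable_bound)
    show "integrable lebesgue (\<lambda>x. B * (indicator ?K x *\<^sub>R g x))"
      using g by simp
    have "\<phi> \<in> borel_measurable lebesgue"
      using test_functions_borel_measurable[OF \<phi>] by (simp add: measurable_completion)
    then show "(\<lambda>x. \<phi> x * (indicator ?K x *\<^sub>R g x)) \<in> borel_measurable lebesgue"
      using g by (intro borel_measurable_times) auto
    show "AE x in lebesgue. norm (\<phi> x * (indicator ?K x *\<^sub>R g x)) \<le> norm (B * (indicator ?K x *\<^sub>R g x))"
      using B order_trans[OF B abs_ge_self] by (auto simp: abs_mult intro!: mult_right_mono)
  qed
  moreover have "\<phi> x * (indicator ?K x *\<^sub>R g x) = indicator \<Omega> x *\<^sub>R (g x * \<phi> x)" for x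
    using closure_subset[of "{x. \<phi> x \<noteq> 0}"] test_functions_eq_0[OF \<phi>, of x] by (auto simp: indicator_def)
  ultimately have "integrable lebesgue (\<lambda>x. indicator \<Omega> x *\<^sub>R (g x * \<phi> x))"
    by (simp only:)
  then show ?thesis
    using assms(1) by (subst integrable_restrict_space) auto
qed

lemma test_functions_integrable:
  assumes "\<phi> \<in> test_functions \<Omega>"
  shows "integrable lborel \<phi>"
proof -
  let ?K = "closure {x. \<phi> x \<noteq> 0}"
  have "integrable lborel (\<lambda>x. indicator ?K x *\<^sub>R \<phi> x)"
    using assms test_functions_continuous[OF assms]
    by (intro borel_integrable_compact) (auto simp: test_functions_def intro: continuous_on_subset)
  moreover have "indicator ?K x *\<^sub>R \<phi> x = \<phi> x" for x
    using closure_subset[of "{x. \<phi> x \<noteq> 0}"] by (auto simp: indicator_def)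
  ultimately show ?thesis by (simp only:)
qed

lemma lborel_integral_translate:
  fixes f :: "'a::euclidean_space \<Rightarrow> real"
  assumes "f \<in> borel_measurable borel"
  shows "(LINT x|lborel. f (c + x)) = (LINT x|lborel. f x)"
proof -
  have "(LINT x|lborel. f x) = (LINT x|distr lborel borel ((+) c). f x)"
    by (simp add: lborel_distr_plus)
  also have "\<dots> = (LINT x|lborel. f (c + x))"
    using assms by (subst integral_distr) auto
  finally show ?thesis by simp
qed

text \<open>
The integral of \<open>(\<phi> (x + s e\<^sub>i) - \<phi> x) / s\<close> vanishes for every \<open>s > 0\<close> by translation invariance, and dominated
convergence lets \<open>s\<close> tend to \<open>0\<close>.
\<close>

lemma integral_partial_deriv_test:
  fixes \<phi> :: "real ^ 'm::finite \<Rightarrow> real"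
  assumes \<phi>: "\<phi> \<in> test_functions \<Omega>"
  shows "(LINT x|lborel. partial_deriv i \<phi> x) = 0"
proof -
  let ?e = "axis i 1 :: real ^ 'm"
  let ?K = "closure {x. \<phi> x \<noteq> 0}"
  \<comment> \<open>The difference quotients with steps in \<open>(0, 1]\<close> vanish off this compact set.\<close>
  define K where "K = {x + y | x y. x \<in> ?K \<and> y \<in> closed_segment 0 (- ?e)}"
  define s :: "nat \<Rightarrow> real" where "s n = inverse (Suc n)" for n
  have s: "s n > 0" "s n \<le> 1" "s \<longlonglongrightarrow> 0" for n
    unfolding s_def using LIMSEQ_inverse_real_of_nat by (auto simp: field_simps)
  define D where "D n x = (\<phi> (s n *\<^sub>R ?e + x) - \<phi> x) / s n" for n x
  obtain B where B: "\<And>x. \<bar>partial_deriv i \<phi> x\<bar> \<le> B"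
    using test_functions_bounded[OF test_functions_partial_deriv[OF \<phi>]] by blast
  have B0: "B \<ge> 0" using B[of 0] by linarith
  have "compact K"
    using \<phi> unfolding K_def by (intro compact_sums) (auto simp: test_functions_def)
  have meas: "\<phi> \<in> borel_measurable borel" "(\<lambda>x. \<phi> (c + x)) \<in> borel_measurable borel" for c
    using test_functions_borel_measurable[OF \<phi>] by measurable
  have "(\<lambda>n. LINT x|lborel. D n x) \<longlonglongrightarrow> (LINT x|lborel. partial_deriv i \<phi> x)"
  proof (rule integral_dominated_convergence[where w = "\<lambda>x. B * indicator K x"])
    show "partial_deriv i \<phi> \<in> borel_measurable lborel"
      using test_functions_borel_measurable[OF test_functions_partial_deriv[OF \<phi>]] by simp
    show "D n \<in> borel_measurable lborel" for n
      unfolding D_def using meas by measurable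
    show "integrable lborel (\<lambda>x. B * indicator K x)"
      using \<open>compact K\<close> emeasure_compact_finite[of K]
      by (auto intro!: integrable_real_indicator borel_compact)
    show "AE x in lborel. (\<lambda>n. D n x) \<longlonglongrightarrow> partial_deriv i \<phi> x"
    proof (rule AE_I2)
      fix x
      have "((\<lambda>h. (\<phi> (x + (0 + h) *\<^sub>R ?e) - \<phi> (x + 0 *\<^sub>R ?e)) / h) \<longlongrightarrow> partial_deriv i \<phi> (x + 0 *\<^sub>R ?e)) (at 0)"
        using DERIV_along_axis[OF test_functions_differentiable[OF \<phi>], where y = x and i = i and t = 0] by (simp only: DERIV_def)
      moreover have "filterlim s (at 0) sequentially"
        using s by (auto simp: filterlim_at less_imp_neq[symmetric])
      ultimately show "(\<lambda>n. D n x) \<longlonglongrightarrow> partial_deriv i \<phi> x"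
        using filterlim_compose unfolding D_def by (fastforce simp: add.commute)
    qed
    show "AE x in lborel. norm (D n x) \<le> B * indicator K x" for n
    proof (rule AE_I2)
      fix x
      show "norm (D n x) \<le> B * indicator K x"
      proof (cases "x \<in> K")
        case True
        obtain z where "\<phi> (x + s n *\<^sub>R ?e) - \<phi> (x + 0 *\<^sub>R ?e) = (s n - 0) * partial_deriv i \<phi> (x + z *\<^sub>R ?e)"
          using MVT2[OF s(1) DERIV_along_axis[OF test_functions_differentiable[OF \<phi>], where y = x and i = i]] by blast
        then have "D n x = partial_deriv i \<phi> (x + z *\<^sub>R ?e)"
          using s(1)[of n] by (simp add: D_def add.commute)
        then show ?thesis using True B by simp
      next
        case False
        have "0 \<in> closed_segment 0 (- ?e)" by simp
        then have "x \<notin> ?K" using False unfolding K_def by force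
        then have 1: "\<phi> x = 0" using closure_subset[of "{x. \<phi> x \<noteq> 0}"] by auto
        have "- (s n *\<^sub>R ?e) \<in> closed_segment 0 (- ?e)"
          using s(1,2)[of n] by (auto simp: in_segment intro!: exI[of _ "s n"])
        moreover have "x = (s n *\<^sub>R ?e + x) + (- (s n *\<^sub>R ?e))" by simp
        ultimately have "s n *\<^sub>R ?e + x \<notin> ?K" using False unfolding K_def by blast
        then have 2: "\<phi> (s n *\<^sub>R ?e + x) = 0" using closure_subset[of "{x. \<phi> x \<noteq> 0}"] by auto
        show ?thesis using 1 2 False by (simp add: D_def)
      qed
    qed
  qed
  moreover have "(LINT x|lborel. D n x) = 0" for n
  proof -
    have "integrable lborel \<phi>" using test_functions_integrable[OF \<phi>] .
    moreover have "integrable lborel (\<lambda>x. \<phi> (s n *\<^sub>R ?e + x))"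
    proof -
      have "integrable (distr lborel borel ((+) (s n *\<^sub>R ?e))) \<phi>"
        using test_functions_integrable[OF \<phi>] by (simp add: lborel_distr_plus)
      then show ?thesis using meas by (subst (asm) integrable_distr_eq) auto
    qed
    ultimately show ?thesis
      unfolding D_def using lborel_integral_translate[OF meas(1)] by simp
  qed
  ultimately show ?thesis by (simp add: LIMSEQ_const_iff)
qed

lemma integral_lebesgue_on_eq_lborel:
  fixes f :: "real ^ 'm::finite \<Rightarrow> real"
  assumes "open \<Omega>" "f \<in> borel_measurable borel" "\<And>x. x \<notin> \<Omega> \<Longrightarrow> f x = 0"
  shows "(LINT x|lebesgue_on \<Omega>. f x) = (LINT x|lborel. f x)"
proof -
  have "(LINT x|lebesgue_on \<Omega>. f x) = (LINT x|lebesgue. indicator \<Omega> x *\<^sub>R f x)"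
    using assms(1) by (intro integral_restrict_space) auto
  also have "(\<lambda>x. indicator \<Omega> x *\<^sub>R f x) = f"
    using assms(3) by (auto simp: indicator_def fun_eq_iff)
  also have "(LINT x|lebesgue. f x) = (LINT x|lborel. f x)"
    using assms(2) by (intro integral_completion) auto
  finally show ?thesis .
qed

text \<open>
Integration by parts: the product of a smooth function and a test function is a test function,
so the integral of its derivative vanishes.
\<close>

lemma smooth_has_weak_partial:
  fixes f :: "real ^ 'm::finite \<Rightarrow> real"
  assumes "open \<Omega>" and f: "\<And>k. C_diff k f"
  shows "has_weak_partial \<Omega> i f (partial_deriv i f)"
  unfolding has_weak_partial_def
proof (intro conjI ballI)
  have f': "\<And>k. C_diff k (partial_deriv i f)"
    using f by (metis C_diff.simps(2))
  show li: "locally_integrable \<Omega> f" "locally_integrable \<Omega> (partial_deriv i f)"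
    using f[of 0] f'[of 0] by (auto intro: continuous_imp_locally_integrable)
  fix \<phi> assume \<phi>: "\<phi> \<in> test_functions \<Omega>"
  have "(LINT x|lebesgue_on \<Omega>. f x * partial_deriv i \<phi> x) + (LINT x|lebesgue_on \<Omega>. partial_deriv i f x * \<phi> x)
    = (LINT x|lebesgue_on \<Omega>. f x * partial_deriv i \<phi> x + partial_deriv i f x * \<phi> x)"
    using locally_integrable_times_test[OF assms(1) li(1) test_functions_partial_deriv[OF \<phi>]]
      locally_integrable_times_test[OF assms(1) li(2) \<phi>]
    by (intro Bochner_Integration.integral_add[symmetric])
  also have "(\<lambda>x. f x * partial_deriv i \<phi> x + partial_deriv i f x * \<phi> x) = partial_deriv i (\<lambda>x. f x * \<phi> x)"
    using f[of "Suc 0"] test_functions_differentiable[OF \<phi>]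
    by (intro ext partial_deriv_mult[symmetric]) auto
  also have "(LINT x|lebesgue_on \<Omega>. partial_deriv i (\<lambda>x. f x * \<phi> x) x)
      = (LINT x|lborel. partial_deriv i (\<lambda>x. f x * \<phi> x) x)"
    using test_functions_partial_deriv[OF test_functions_mult[OF \<phi> f]]
    by (intro integral_lebesgue_on_eq_lborel assms test_functions_borel_measurable test_functions_eq_0)
  also have "\<dots> = 0" by (rule integral_partial_deriv_test[OF test_functions_mult[OF \<phi> f]])
  finally show "(LINT x|lebesgue_on \<Omega>. f x * partial_deriv i \<phi> x) = - (LINT x|lebesgue_on \<Omega>. partial_deriv i f x * \<phi> x)"
    by simp
qed

section \<open>The saturation function\<close>

text \<open>
The uniqueness argument needs a function that vanishes only at \<open>0\<close>, is positive elsewhere and has a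
bounded derivative, and that turns test functions into test functions, hence is smooth. The bounded
derivative rules out the square, and smoothness the absolute value and the positive part.
\<close>

definition saturation :: "real \<Rightarrow> real" where
  "saturation t = 1 - inverse (1 + t\<^sup>2)"

definition saturation' :: "real \<Rightarrow> real" where
  "saturation' t = 2 * t * (inverse (1 + t\<^sup>2))\<^sup>2"

lemma saturation_has_derivative: "(saturation has_real_derivative saturation' t) (at t)"
  unfolding saturation_def saturation'_def
  by (auto intro!: derivative_eq_intros simp: add_nonneg_eq_0_iff power2_eq_square)

lemma saturation_bounds: "0 \<le> saturation t" "saturation t \<le> 1"
  by (auto simp: saturation_def inverse_le_1_iff add_nonneg_eq_0_iff)

lemma saturation_eq_0_iff: "saturation t = 0 \<longleftrightarrow> t = 0"
  by (auto simp: saturation_def field_simps add_nonneg_eq_0_iff)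

lemma saturation'_le_1: "\<bar>saturation' t\<bar> \<le> 1"
proof -
  let ?h = "inverse (1 + t\<^sup>2)"
  have h: "0 < ?h" "?h \<le> 1" by (auto simp: inverse_le_1_iff add_pos_nonneg)
  have "2 * \<bar>t\<bar> \<le> 1 + t\<^sup>2"
    using zero_le_power2[of "\<bar>t\<bar> - 1"] by (simp add: power2_eq_square algebra_simps)
  then have "2 * \<bar>t\<bar> * ?h \<le> (1 + t\<^sup>2) * ?h"
    using h by (intro mult_right_mono) auto
  also have "(1 + t\<^sup>2) * ?h = 1"
    by (simp add: add_nonneg_eq_0_iff)
  finally have "(2 * \<bar>t\<bar> * ?h) * ?h \<le> 1 * 1"
    using h by (intro mult_mono) auto
  then show ?thesis using h by (simp add: saturation'_def power2_eq_square abs_mult mult_ac)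
qed

lemma saturation_Lipschitz: "\<bar>saturation s - saturation t\<bar> \<le> \<bar>s - t\<bar>"
  using field_differentiable_bound[of UNIV saturation saturation' 1 s t]
    saturation_has_derivative saturation'_le_1 by (simp add: has_field_derivative_at_within)

lemma saturation_tendsto_1:
  assumes "c > 0"
  shows "(\<lambda>n. saturation (real n * c)) \<longlonglongrightarrow> 1"
proof -
  have "(\<lambda>n. 1 - inverse (1 + (real n * c)\<^sup>2)) \<longlonglongrightarrow> 1 - 0"
    using assms by (intro tendsto_intros tendsto_inverse_0_at_top filterlim_tendsto_add_at_top[OF tendsto_const]
      filterlim_pow_at_top filterlim_at_top_mult_tendsto_pos[OF tendsto_const] filterlim_real_sequentially) auto
  then show ?thesis by (simp add: saturation_def)
qed

lemma borel_measurable_saturation: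
  "saturation \<in> borel_measurable borel" "saturation' \<in> borel_measurable borel"
  unfolding saturation_def[abs_def] saturation'_def[abs_def] by measurable

lemma test_functions_saturation:
  assumes \<phi>: "\<phi> \<in> test_functions \<Omega>"
  shows "(\<lambda>x. saturation (\<phi> x)) \<in> test_functions \<Omega>"
proof (rule test_functions_smaller_support[OF \<phi>])
  show "C_diff k (\<lambda>x. saturation (\<phi> x))" for k
  proof -
    have "C_diff k (\<lambda>x. 1 + (-1) * inverse (1 + (\<phi> x)\<^sup>2))"
      using test_functions_C_diff[OF \<phi>]
      by (intro C_diff_add C_diff_mult C_diff_const C_diff_inverse_1_plus_square)
    then show ?thesis by (simp add: saturation_def)
  qed
  show "{x. saturation (\<phi> x) \<noteq> 0} \<subseteq> closure {x. \<phi> x \<noteq> 0}"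
    using closure_subset[of "{x. \<phi> x \<noteq> 0}"] by (auto simp: saturation_eq_0_iff)
qed

lemma partial_deriv_saturation:
  assumes "\<phi> \<in> test_functions \<Omega>"
  shows "partial_deriv i (\<lambda>x. saturation (\<phi> x)) x = saturation' (\<phi> x) * partial_deriv i \<phi> x"
  using partial_deriv_chain(2)[OF test_functions_differentiable[OF assms] saturation_has_derivative] .

section \<open>The fundamental lemma of the calculus of variations\<close>

lemma box_bump:
  fixes a b :: "real ^ 'm::finite"
  assumes "cbox a b \<subseteq> \<Omega>"
  obtains \<phi> where "\<phi> \<in> test_functions \<Omega>" "\<And>x. 0 \<le> \<phi> x" "\<And>x. 0 < \<phi> x \<longleftrightarrow> x \<in> box a b"
proof
  let ?\<phi> = "\<lambda>x. \<Prod>j\<in>UNIV. flat_exp 0 (1 * (x $ j - a $ j)) * flat_exp 0 ((-1) * (x $ j - b $ j))"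
  show nn: "0 \<le> ?\<phi> x" for x by (intro prod_nonneg) (simp add: flat_exp_nonneg)
  have pos: "0 < flat_exp 0 t \<longleftrightarrow> t > 0" "flat_exp 0 t = 0 \<longleftrightarrow> t \<le> 0" for t
    by (auto simp: flat_exp_def)
  show supp: "0 < ?\<phi> x \<longleftrightarrow> x \<in> box a b" for x
  proof -
    have "?\<phi> x \<noteq> 0 \<longleftrightarrow> x \<in> box a b"
      by (auto simp: mem_box_cart pos not_le)
    then show ?thesis using nn[of x] by linarith
  qed
  have "closure {x. ?\<phi> x \<noteq> 0} \<subseteq> cbox a b"
    using supp nn box_subset_cbox by (intro closure_minimal) (force simp: less_le)+
  moreover from this have "compact (closure {x. ?\<phi> x \<noteq> 0})"
    using compact_Int_closed[of "cbox a b" "closure {x. ?\<phi> x \<noteq> 0}"] by (simp add: Int_absorb1)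
  moreover have "C_diff k ?\<phi>" for k
    by (intro C_diff_prod C_diff_mult C_diff_flat_exp_coord finite)
  ultimately show "?\<phi> \<in> test_functions \<Omega>"
    unfolding test_functions_def using assms by blast
qed

text \<open>
If \<open>\<phi>\<close> is positive exactly on the open box, then \<open>saturation (n \<phi>)\<close> increases to the indicator of the box. These
are test functions, and dominated convergence applies.
\<close>

lemma fundamental_lemma_box:
  fixes h :: "real ^ 'm::finite \<Rightarrow> real"
  assumes "open \<Omega>" and h: "locally_integrable \<Omega> h"
    and orth: "\<And>\<phi>. \<phi> \<in> test_functions \<Omega> \<Longrightarrow> (LINT x|lebesgue_on \<Omega>. h x * \<phi> x) = 0"
    and ab: "cbox a b \<subseteq> \<Omega>"
  shows "integral (cbox a b) h = 0"
proof -
  obtain \<phi> where \<phi>: "\<phi> \<in> test_functions \<Omega>" "\<And>x. 0 \<le> \<phi> x" "\<And>x. 0 < \<phi> x \<longleftrightarrow> x \<in> box a b"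
    using box_bump[OF ab] by blast
  have int: "integrable lebesgue (\<lambda>x. indicator (cbox a b) x *\<^sub>R h x)"
    using h ab by (auto simp: locally_integrable_def set_integrable_def)
  have "integrable lebesgue (\<lambda>x. indicator (box a b) x *\<^sub>R (indicator (cbox a b) x *\<^sub>R h x))"
    by (intro integrable_mult_indicator int) auto
  also have "(\<lambda>x. indicator (box a b) x *\<^sub>R (indicator (cbox a b) x *\<^sub>R h x)) = (\<lambda>x. indicator (box a b) x *\<^sub>R h x)"
    using box_subset_cbox[of a b] by (auto simp: indicator_def fun_eq_iff)
  finally have int': "set_integrable lebesgue (box a b) h" by (simp add: set_integrable_def)
  have test: "(\<lambda>x. saturation (real n * \<phi> x)) \<in> test_functions \<Omega>" for n
    by (intro test_functions_saturation test_functions_mult \<phi>(1) C_diff_const)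
  have off: "\<phi> x = 0" if "x \<notin> box a b" for x
    using that \<phi>(2,3)[of x] by linarith
  have "(\<lambda>n. LINT x|lebesgue. saturation (real n * \<phi> x) * (indicator (box a b) x *\<^sub>R h x))
      \<longlonglongrightarrow> (LINT x|lebesgue. indicator (box a b) x *\<^sub>R h x)"
  proof (rule integral_dominated_convergence[where w = "\<lambda>x. norm (indicator (box a b) x *\<^sub>R h x)"])
    show "(\<lambda>x. indicator (box a b) x *\<^sub>R h x) \<in> borel_measurable lebesgue"
      using int' by (simp add: set_integrable_def del: real_scaleR_def)
    then show "(\<lambda>x. saturation (real n * \<phi> x) * (indicator (box a b) x *\<^sub>R h x)) \<in> borel_measurable lebesgue" for n
      by (intro borel_measurable_times[OF measurable_completion])
         (simp_all add: test_functions_borel_measurable[OF test])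
    show "integrable lebesgue (\<lambda>x. norm (indicator (box a b) x *\<^sub>R h x))"
      using int' by (simp only: set_integrable_def integrable_norm)
    show "AE x in lebesgue. (\<lambda>n. saturation (real n * \<phi> x) * (indicator (box a b) x *\<^sub>R h x)) \<longlonglongrightarrow> indicator (box a b) x *\<^sub>R h x"
    proof (rule AE_I2)
      fix x
      show "(\<lambda>n. saturation (real n * \<phi> x) * (indicator (box a b) x *\<^sub>R h x)) \<longlonglongrightarrow> indicator (box a b) x *\<^sub>R h x"
        using tendsto_mult[OF saturation_tendsto_1 tendsto_const, of "\<phi> x" "h x"] \<phi>(3)[of x]
        by (cases "x \<in> box a b") auto
    qed
    show "AE x in lebesgue. norm (saturation (real n * \<phi> x) * (indicator (box a b) x *\<^sub>R h x)) \<le> norm (indicator (box a b) x *\<^sub>R h x)" for n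
      using saturation_bounds by (auto simp: abs_mult intro!: mult_left_le_one_le)
  qed
  moreover have "(LINT x|lebesgue. saturation (real n * \<phi> x) * (indicator (box a b) x *\<^sub>R h x)) = 0" for n
  proof -
    have "(LINT x|lebesgue. saturation (real n * \<phi> x) * (indicator (box a b) x *\<^sub>R h x))
       = (LINT x|lebesgue. indicator \<Omega> x *\<^sub>R (h x * saturation (real n * \<phi> x)))"
      using off ab box_subset_cbox[of a b]
      by (intro Bochner_Integration.integral_cong) (auto simp: indicator_def saturation_eq_0_iff)
    also have "\<dots> = (LINT x|lebesgue_on \<Omega>. h x * saturation (real n * \<phi> x))"
      using \<open>open \<Omega>\<close> by (intro integral_restrict_space[symmetric]) auto
    also have "\<dots> = 0" by (rule orth[OF test])
    finally show ?thesis .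
  qed
  ultimately have "(LINT x|lebesgue. indicator (box a b) x *\<^sub>R h x) = 0"
    by (simp add: LIMSEQ_const_iff)
  then have "integral (box a b) h = 0"
    using set_lebesgue_integral_eq_integral(2)[OF int'] by (simp add: set_lebesgue_integral_def)
  then show ?thesis by (simp add: integral_open_interval)
qed

text \<open>
Lebesgue's differentiation theorem recovers \<open>h\<close> almost everywhere from its averages over small cubes, and
these averages vanish. As \<open>h\<close> is only locally integrable, the theorem is applied to \<open>h\<close> cut off to one of
countably many closed boxes that cover \<open>\<Omega>\<close>.
\<close>

lemma fundamental_lemma:
  fixes h :: "real ^ 'm::finite \<Rightarrow> real"
  assumes "open \<Omega>" and h: "locally_integrable \<Omega> h"
    and orth: "\<And>\<phi>. \<phi> \<in> test_functions \<Omega> \<Longrightarrow> (LINT x|lebesgue_on \<Omega>. h x * \<phi> x) = 0"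
  shows "AE x in lebesgue_on \<Omega>. h x = 0"
proof -
  have cell: "negligible {x \<in> cbox a b. h x \<noteq> 0}" if ab: "cbox a b \<subseteq> \<Omega>" for a b
  proof -
    define f where "f x = (if x \<in> cbox a b then h x else 0)" for x
    have "set_integrable lebesgue (cbox a b) h"
      using h ab by (auto simp: locally_integrable_def)
    then have "h integrable_on cbox a b" by (rule set_lebesgue_integral_eq_integral(1))
    then have "f integrable_on UNIV"
      unfolding f_def by (simp add: integrable_restrict_UNIV)
    then have "f integrable_on cbox c d" for c d
      by (rule integrable_on_subcbox) auto
    then obtain N where N: "negligible N" and
      lim: "\<And>x e. \<lbrakk>x \<notin> N; 0 < e\<rbrakk> \<Longrightarrow> \<exists>d>0. \<forall>r. 0 < r \<and> r < d \<longrightarrow>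
        norm (integral (cbox x (x + r *\<^sub>R One)) f /\<^sub>R r ^ DIM(real ^ 'm) - f x) < e"
      using integrable_ccontinuous_explicit by blast
    have "h x = 0" if x: "x \<in> box a b" "x \<notin> N" for x
    proof (rule ccontr)
      assume "h x \<noteq> 0"
      have fx: "f x = h x" using x box_subset_cbox[of a b] by (auto simp: f_def)
      obtain d where d: "d > 0" "\<And>r. 0 < r \<Longrightarrow> r < d \<Longrightarrow>
        norm (integral (cbox x (x + r *\<^sub>R One)) f /\<^sub>R r ^ DIM(real ^ 'm) - f x) < \<bar>h x\<bar>"
        using lim[OF x(2), of "\<bar>h x\<bar>"] \<open>h x \<noteq> 0\<close> by auto
      obtain r0 where r0: "r0 > 0" "ball x r0 \<subseteq> box a b"
        using x(1) open_box open_contains_ball by blast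
      \<comment> \<open>A cube at \<open>x\<close> whose diagonal is shorter than the radius \<open>r0\<close>; the summand \<open>1\<close> only makes \<open>w\<close> positive.\<close>
      define w where "w = 1 + norm (One :: real ^ 'm)"
      have w: "w > 0" by (auto simp: w_def add_pos_nonneg)
      define r where "r = min (d / 2) (r0 / (2 * w))"
      have r: "0 < r" "r < d"
        using d(1) r0(1) w by (auto simp: r_def)
      have "r * norm (One :: real ^ 'm) \<le> r * w"
        using r by (intro mult_left_mono) (auto simp: w_def)
      also have "\<dots> \<le> (r0 / (2 * w)) * w"
        unfolding r_def using w by (intro mult_right_mono) auto
      also have "\<dots> = r0 / 2" using w by simp
      finally have "r * norm (One :: real ^ 'm) < r0" using r0(1) by linarith
      then have "x + r *\<^sub>R One \<in> box a b"
        using r0(2) r by (auto simp: dist_norm)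
      then have sub: "cbox x (x + r *\<^sub>R One) \<subseteq> box a b"
        using x(1) by (force simp: mem_box)
      have "integral (cbox x (x + r *\<^sub>R One)) f = integral (cbox x (x + r *\<^sub>R One)) h"
        using sub box_subset_cbox[of a b] by (intro Henstock_Kurzweil_Integration.integral_cong) (auto simp: f_def)
      also have "\<dots> = 0"
        using sub box_subset_cbox[of a b] ab by (intro fundamental_lemma_box[OF assms]) auto
      finally show False using d(2)[OF r] fx by simp
    qed
    then have "{x \<in> cbox a b. h x \<noteq> 0} \<subseteq> N \<union> (cbox a b - box a b)" by auto
    then show ?thesis
      using N negligible_frontier_interval[of a b] negligible_subset negligible_Un by blast
  qed
  obtain \<D> where \<D>: "countable \<D>" "\<D> \<subseteq> Pow \<Omega>" "\<And>X. X \<in> \<D> \<Longrightarrow> \<exists>a b. X = cbox a b" "\<Union>\<D> = \<Omega>"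
    using open_countable_Union_open_cbox[OF \<open>open \<Omega>\<close>] by blast
  have "negligible (\<Union>X\<in>\<D>. {x \<in> X. h x \<noteq> 0})"
    using \<D>(1)
  proof (rule negligible_countable_Union[OF countable_image], safe)
    fix X assume "X \<in> \<D>"
    then show "negligible {x \<in> X. h x \<noteq> 0}"
      using \<D>(2,3) cell by blast
  qed
  also have "(\<Union>X\<in>\<D>. {x \<in> X. h x \<noteq> 0}) = {x \<in> \<Omega>. h x \<noteq> 0}" using \<D>(4) by auto
  finally have null: "{x \<in> \<Omega>. h x \<noteq> 0} \<in> null_sets lebesgue"
    by (simp add: negligible_iff_null_sets)
  have "AE x in lebesgue. x \<in> \<Omega> \<longrightarrow> h x = 0"
    by (rule AE_I'[OF null]) auto
  then show ?thesis
    using \<open>open \<Omega>\<close> by (subst AE_restrict_space_iff) auto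
qed

section \<open>Weak derivatives\<close>

lemma locally_integrable_lincomb:
  "locally_integrable \<Omega> f \<Longrightarrow> locally_integrable \<Omega> g \<Longrightarrow> locally_integrable \<Omega> (\<lambda>x. c * f x + d * g x)"
  unfolding locally_integrable_def by (auto intro!: set_integral_add set_integrable_mult_right)

lemma has_weak_partial_lincomb:
  assumes "open \<Omega>" and f: "has_weak_partial \<Omega> i f f'" and g: "has_weak_partial \<Omega> i g g'"
  shows "has_weak_partial \<Omega> i (\<lambda>x. c * f x + d * g x) (\<lambda>x. c * f' x + d * g' x)"
proof -
  have li: "locally_integrable \<Omega> f" "locally_integrable \<Omega> f'" "locally_integrable \<Omega> g" "locally_integrable \<Omega> g'"
    using f g by (auto simp: has_weak_partial_def)
  have lin: "(LINT x|lebesgue_on \<Omega>. (c * p x + d * q x) * \<psi> x)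
     = c * (LINT x|lebesgue_on \<Omega>. p x * \<psi> x) + d * (LINT x|lebesgue_on \<Omega>. q x * \<psi> x)"
    if "locally_integrable \<Omega> p" "locally_integrable \<Omega> q" "\<psi> \<in> test_functions \<Omega>" for p q \<psi>
    using locally_integrable_times_test[OF assms(1) that(1,3)] locally_integrable_times_test[OF assms(1) that(2,3)]
    by (simp add: algebra_simps)
  show ?thesis
    unfolding has_weak_partial_def
  proof (intro conjI ballI)
    fix \<phi> assume \<phi>: "\<phi> \<in> test_functions \<Omega>"
    show "(LINT x|lebesgue_on \<Omega>. (c * f x + d * g x) * partial_deriv i \<phi> x)
        = - (LINT x|lebesgue_on \<Omega>. (c * f' x + d * g' x) * \<phi> x)"
      using f g \<phi>
      unfolding lin[OF li(1,3) test_functions_partial_deriv[OF \<phi>]] lin[OF li(2,4) \<phi>]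
      by (simp add: has_weak_partial_def)
  qed (intro locally_integrable_lincomb li)+
qed

lemma has_weak_partial_unique:
  assumes "open \<Omega>" and g: "has_weak_partial \<Omega> i f g" and h: "has_weak_partial \<Omega> i f h"
  shows "AE x in lebesgue_on \<Omega>. g x = h x"
proof -
  have "has_weak_partial \<Omega> i (\<lambda>x. 1 * f x + (-1) * f x) (\<lambda>x. 1 * g x + (-1) * h x)"
    by (rule has_weak_partial_lincomb[OF assms])
  then have d: "has_weak_partial \<Omega> i (\<lambda>x. 0) (\<lambda>x. g x - h x)" by simp
  have "AE x in lebesgue_on \<Omega>. g x - h x = 0"
    using d by (intro fundamental_lemma[OF \<open>open \<Omega>\<close>]) (auto simp: has_weak_partial_def)
  then show ?thesis by simp
qed

text \<open>
Passes from the arbitrary choice made by \<^const>\<open>weak_partial\<close> to any concrete weak derivative.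
\<close>

lemma AE_eq_weak_partial:
  assumes "open \<Omega>" "has_weak_partial \<Omega> i f g"
  shows "AE x in lebesgue_on \<Omega>. weak_partial \<Omega> i f x = g x"
  unfolding weak_partial_def using assms someI[of "has_weak_partial \<Omega> i f" g]
  by (blast intro: has_weak_partial_unique)

lemma borel_measurable_lebesgue_on_AE:
  fixes f :: "'a::euclidean_space \<Rightarrow> 'b::euclidean_space"
  assumes "S \<in> sets lebesgue" "f \<in> borel_measurable (lebesgue_on S)"
    and ae: "AE x in lebesgue_on S. f x = g x"
  shows "g \<in> borel_measurable (lebesgue_on S)"
proof -
  have "(\<lambda>x. if x \<in> S then f x else 0) \<in> borel_measurable lebesgue"
    using assms by (simp add: borel_measurable_if)
  moreover have "AE x in lebesgue. (if x \<in> S then f x else 0) = (if x \<in> S then g x else 0)"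
    using ae assms(1) by (subst (asm) AE_restrict_space_iff) auto
  ultimately have "(\<lambda>x. if x \<in> S then g x else 0) \<in> borel_measurable lebesgue"
    by (rule borel_measurable_AE)
  then show ?thesis using assms(1) by (simp add: borel_measurable_if)
qed

lemma L2_AE:
  assumes "open \<Omega>" "f \<in> L2 \<Omega>" "AE x in lebesgue_on \<Omega>. f x = g x"
  shows "g \<in> L2 \<Omega>"
proof -
  have g: "g \<in> borel_measurable (lebesgue_on \<Omega>)"
    using assms by (auto simp: L2_def intro: borel_measurable_lebesgue_on_AE[OF _ _ assms(3)])
  moreover have "integrable (lebesgue_on \<Omega>) (\<lambda>x. (f x)\<^sup>2) \<longleftrightarrow> integrable (lebesgue_on \<Omega>) (\<lambda>x. (g x)\<^sup>2)"
    using g assms by (intro integrable_cong_AE) (auto simp: L2_def)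
  ultimately show ?thesis using assms(2) by (simp add: L2_def)
qed

text \<open>
Membership in \<^const>\<open>W12\<close> provides some square-integrable weak derivative; by uniqueness the chosen one agrees
with it almost everywhere and inherits square integrability.
\<close>

lemma W12_weak_partial:
  assumes "open \<Omega>" "f \<in> W12 \<Omega>"
  shows "has_weak_partial \<Omega> i f (weak_partial \<Omega> i f)" "weak_partial \<Omega> i f \<in> L2 \<Omega>"
proof -
  obtain g where g: "g \<in> L2 \<Omega>" "has_weak_partial \<Omega> i f g"
    using assms(2) by (auto simp: W12_def)
  then show "has_weak_partial \<Omega> i f (weak_partial \<Omega> i f)"
    unfolding weak_partial_def by (metis someI)
  have "AE x in lebesgue_on \<Omega>. g x = weak_partial \<Omega> i f x"
    using AE_eq_weak_partial[OF assms(1) g(2)] by eventually_elim simp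
  then show "weak_partial \<Omega> i f \<in> L2 \<Omega>" by (rule L2_AE[OF assms(1) g(1)])
qed

lemma L2_mult_integrable:
  assumes "f \<in> L2 \<Omega>" "g \<in> L2 \<Omega>"
  shows "integrable (lebesgue_on \<Omega>) (\<lambda>x. f x * g x)"
proof (rule Bochner_Integration.integrable_bound)
  show "integrable (lebesgue_on \<Omega>) (\<lambda>x. (f x)\<^sup>2 + (g x)\<^sup>2)"
    using assms by (simp add: L2_def)
  show "(\<lambda>x. f x * g x) \<in> borel_measurable (lebesgue_on \<Omega>)"
    using assms by (auto simp: L2_def intro: borel_measurable_times)
  have "\<bar>s * t\<bar> \<le> s\<^sup>2 + t\<^sup>2" for s t :: real
    using sum_squares_bound[of "\<bar>s\<bar>" "\<bar>t\<bar>"] mult_nonneg_nonneg[of "\<bar>s\<bar>" "\<bar>t\<bar>"]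
    unfolding abs_mult power2_abs by linarith
  then show "AE x in lebesgue_on \<Omega>. norm (f x * g x) \<le> norm ((f x)\<^sup>2 + (g x)\<^sup>2)"
    by (simp add: abs_of_nonneg)
qed

lemma L2_lincomb:
  assumes "f \<in> L2 \<Omega>" "g \<in> L2 \<Omega>"
  shows "(\<lambda>x. c * f x + d * g x) \<in> L2 \<Omega>"
proof -
  have "integrable (lebesgue_on \<Omega>) (\<lambda>x. c\<^sup>2 * (f x)\<^sup>2 + 2 * c * d * (f x * g x) + d\<^sup>2 * (g x)\<^sup>2)"
    using assms L2_mult_integrable[OF assms] by (simp add: L2_def)
  moreover have "(\<lambda>x. c\<^sup>2 * (f x)\<^sup>2 + 2 * c * d * (f x * g x) + d\<^sup>2 * (g x)\<^sup>2) = (\<lambda>x. (c * f x + d * g x)\<^sup>2)"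
    by (auto simp: power2_eq_square algebra_simps)
  moreover have "(\<lambda>x. c * f x + d * g x) \<in> borel_measurable (lebesgue_on \<Omega>)"
    using assms by (intro borel_measurable_add borel_measurable_times) (auto simp: L2_def)
  ultimately show ?thesis by (simp add: L2_def)
qed

lemma W12_lincomb:
  assumes "open \<Omega>" "f \<in> W12 \<Omega>" "g \<in> W12 \<Omega>"
  shows "(\<lambda>x. c * f x + d * g x) \<in> W12 \<Omega>"
    and "AE x in lebesgue_on \<Omega>. weak_partial \<Omega> i (\<lambda>x. c * f x + d * g x) x
       = c * weak_partial \<Omega> i f x + d * weak_partial \<Omega> i g x"
proof -
  have wp: "has_weak_partial \<Omega> i (\<lambda>x. c * f x + d * g x)
      (\<lambda>x. c * weak_partial \<Omega> i f x + d * weak_partial \<Omega> i g x)" for i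
    using assms by (intro has_weak_partial_lincomb W12_weak_partial)
  then show "AE x in lebesgue_on \<Omega>. weak_partial \<Omega> i (\<lambda>x. c * f x + d * g x) x
       = c * weak_partial \<Omega> i f x + d * weak_partial \<Omega> i g x"
    by (rule AE_eq_weak_partial[OF assms(1)])
  show "(\<lambda>x. c * f x + d * g x) \<in> W12 \<Omega>"
    using assms wp unfolding W12_def
    by (auto intro!: L2_lincomb W12_weak_partial(2)[unfolded W12_def] exI bexI)
qed

section \<open>Square-integrable functions\<close>

lemma L2_measurable: "f \<in> L2 \<Omega> \<Longrightarrow> f \<in> borel_measurable (lebesgue_on \<Omega>)"
  by (simp add: L2_def)

lemma L2_square_integrable: "f \<in> L2 \<Omega> \<Longrightarrow> integrable (lebesgue_on \<Omega>) (\<lambda>x. (f x)\<^sup>2)"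
  by (simp add: L2_def)

lemma L2_bounded_by:
  assumes "f \<in> L2 \<Omega>" "g \<in> borel_measurable (lebesgue_on \<Omega>)" "\<And>x. \<bar>g x\<bar> \<le> \<bar>f x\<bar>"
  shows "g \<in> L2 \<Omega>"
proof -
  have "integrable (lebesgue_on \<Omega>) (\<lambda>x. (g x)\<^sup>2)"
    using assms(2,3)
    by (intro Bochner_Integration.integrable_bound[OF L2_square_integrable[OF assms(1)]])
       (auto simp: abs_le_square_iff)
  then show ?thesis using assms(2) by (simp add: L2_def)
qed

lemma L2_zero: "(\<lambda>x. 0) \<in> L2 \<Omega>"
  by (simp add: L2_def)

lemma L2_sum:
  assumes "finite I" "\<And>i. i \<in> I \<Longrightarrow> f i \<in> L2 \<Omega>"
  shows "(\<lambda>x. \<Sum>i\<in>I. c i * f i x) \<in> L2 \<Omega>"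
  using assms
proof (induction I rule: finite_induct)
  case (insert j I)
  then have "(\<lambda>x. c j * f j x + 1 * (\<Sum>i\<in>I. c i * f i x)) \<in> L2 \<Omega>"
    by (intro L2_lincomb) auto
  then show ?case using insert by simp
qed (simp add: L2_zero)

text \<open>
The quadratic form \<open>\<integral> (s |f| - r |g|)\<^sup>2\<close> in \<open>(s, r)\<close> is nonnegative. It is evaluated at \<open>s = \<integral> g\<^sup>2\<close> and
\<open>r = \<integral> |f g|\<close>, or at a large \<open>r\<close> if \<open>g\<close> vanishes.
\<close>

lemma L2_Cauchy_Schwarz:
  assumes f: "f \<in> L2 \<Omega>" and g: "g \<in> L2 \<Omega>"
  shows "(LINT x|lebesgue_on \<Omega>. \<bar>f x * g x\<bar>)\<^sup>2
    \<le> (LINT x|lebesgue_on \<Omega>. (f x)\<^sup>2) * (LINT x|lebesgue_on \<Omega>. (g x)\<^sup>2)"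
proof -
  let ?A = "LINT x|lebesgue_on \<Omega>. (f x)\<^sup>2" and ?B = "LINT x|lebesgue_on \<Omega>. (g x)\<^sup>2"
    and ?C = "LINT x|lebesgue_on \<Omega>. \<bar>f x * g x\<bar>"
  have C: "integrable (lebesgue_on \<Omega>) (\<lambda>x. \<bar>f x * g x\<bar>)"
    using L2_mult_integrable[OF f g] by (rule integrable_abs)
  have nn: "?A \<ge> 0" "?B \<ge> 0" "?C \<ge> 0" by simp_all
  have quad: "0 \<le> s\<^sup>2 * ?A - 2 * s * r * ?C + r\<^sup>2 * ?B" for s r
  proof -
    have "0 \<le> (LINT x|lebesgue_on \<Omega>. s\<^sup>2 * (f x)\<^sup>2 - 2 * s * r * \<bar>f x * g x\<bar> + r\<^sup>2 * (g x)\<^sup>2)"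
    proof (rule Bochner_Integration.integral_nonneg)
      fix x
      have "s\<^sup>2 * (f x)\<^sup>2 - 2 * s * r * \<bar>f x * g x\<bar> + r\<^sup>2 * (g x)\<^sup>2 = (s * \<bar>f x\<bar> - r * \<bar>g x\<bar>)\<^sup>2"
        by (simp add: power2_diff power_mult_distrib abs_mult mult_ac)
      then show "0 \<le> s\<^sup>2 * (f x)\<^sup>2 - 2 * s * r * \<bar>f x * g x\<bar> + r\<^sup>2 * (g x)\<^sup>2" by simp
    qed
    also have "\<dots> = s\<^sup>2 * ?A - 2 * s * r * ?C + r\<^sup>2 * ?B"
      using C L2_square_integrable[OF f] L2_square_integrable[OF g] by simp
    finally show ?thesis .
  qed
  show ?thesis
  proof (cases "?B = 0")
    case True
    have "?C = 0"
    proof (rule ccontr)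
      assume "?C \<noteq> 0"
      then show False using quad[of 1 "(?A + 1) / (2 * ?C)"] True by simp
    qed
    then show ?thesis using nn by simp
  next
    case False
    \<comment> \<open>The choice \<open>s = B\<close>, \<open>r = C\<close> minimizes the form in \<open>r\<close>, up to scaling.\<close>
    have "0 \<le> ?B * (?A * ?B - ?C\<^sup>2)"
      using quad[of ?B ?C] by (simp add: power2_eq_square algebra_simps)
    then show ?thesis using False nn by (simp add: zero_le_mult_iff)
  qed
qed

lemma integral_tendsto_0_L2_dominated:
  assumes f: "\<And>n. f n \<in> L2 \<Omega>" "(\<lambda>n. LINT x|lebesgue_on \<Omega>. (f n x)\<^sup>2) \<longlonglongrightarrow> 0"
    and g: "g \<in> L2 \<Omega>"
    and p: "\<And>n. p n \<in> borel_measurable (lebesgue_on \<Omega>)"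
      "\<And>n. AE x in lebesgue_on \<Omega>. \<bar>p n x\<bar> \<le> \<bar>f n x * g x\<bar>"
  shows "(\<lambda>n. LINT x|lebesgue_on \<Omega>. p n x) \<longlonglongrightarrow> 0"
proof -
  let ?B = "LINT x|lebesgue_on \<Omega>. (g x)\<^sup>2"
  have "(\<lambda>n. sqrt ((LINT x|lebesgue_on \<Omega>. (f n x)\<^sup>2) * ?B)) \<longlonglongrightarrow> sqrt (0 * ?B)"
    by (intro tendsto_intros f)
  then have lim: "(\<lambda>n. sqrt ((LINT x|lebesgue_on \<Omega>. (f n x)\<^sup>2) * ?B)) \<longlonglongrightarrow> 0" by simp
  have "\<bar>LINT x|lebesgue_on \<Omega>. p n x\<bar> \<le> sqrt ((LINT x|lebesgue_on \<Omega>. (f n x)\<^sup>2) * ?B)" for n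
  proof -
    have fg: "integrable (lebesgue_on \<Omega>) (\<lambda>x. \<bar>f n x * g x\<bar>)"
      using L2_mult_integrable[OF f(1) g] by (rule integrable_abs)
    have "integrable (lebesgue_on \<Omega>) (p n)"
      by (rule Bochner_Integration.integrable_bound[OF fg p(1)]) (use p(2)[of n] in simp)
    then have "\<bar>LINT x|lebesgue_on \<Omega>. p n x\<bar> \<le> (LINT x|lebesgue_on \<Omega>. \<bar>f n x * g x\<bar>)"
      by (intro order_trans[OF integral_abs_bound] integral_mono_AE integrable_abs fg p(2))
    also have "\<dots> \<le> sqrt ((LINT x|lebesgue_on \<Omega>. (f n x)\<^sup>2) * ?B)"
      by (intro real_le_rsqrt L2_Cauchy_Schwarz f g)
    finally show ?thesis .
  qed
  then have "\<forall>\<^sub>F n in sequentially. norm (LINT x|lebesgue_on \<Omega>. p n x) \<le> sqrt ((LINT x|lebesgue_on \<Omega>. (f n x)\<^sup>2) * ?B)"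
    by (intro always_eventually) simp
  from Lim_null_comparison[OF this lim] show ?thesis .
qed

lemma test_functions_L2:
  assumes "open \<Omega>" "\<phi> \<in> test_functions \<Omega>"
  shows "\<phi> \<in> L2 \<Omega>"
proof -
  have "integrable (lebesgue_on \<Omega>) (\<lambda>x. \<phi> x * \<phi> x)"
    using assms by (intro locally_integrable_times_test continuous_imp_locally_integrable test_functions_continuous)
  then show ?thesis
    using continuous_borel_measurable_lebesgue_on[OF test_functions_continuous[OF assms(2)]]
    by (simp add: L2_def power2_eq_square)
qed

section \<open>The Sobolev spaces\<close>

lemma test_functions_W12:
  assumes "open \<Omega>" "\<phi> \<in> test_functions \<Omega>"
  shows "\<phi> \<in> W12 \<Omega>" "AE x in lebesgue_on \<Omega>. weak_partial \<Omega> i \<phi> x = partial_deriv i \<phi> x"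
proof -
  have wp: "has_weak_partial \<Omega> i \<phi> (partial_deriv i \<phi>)" for i
    by (intro smooth_has_weak_partial assms(1) test_functions_C_diff[OF assms(2)])
  then show "AE x in lebesgue_on \<Omega>. weak_partial \<Omega> i \<phi> x = partial_deriv i \<phi> x"
    by (rule AE_eq_weak_partial[OF assms(1)])
  show "\<phi> \<in> W12 \<Omega>"
    using wp assms test_functions_L2 test_functions_partial_deriv unfolding W12_def by blast
qed

lemma W12_L2: "f \<in> W12 \<Omega> \<Longrightarrow> f \<in> L2 \<Omega>"
  by (simp add: W12_def)

lemma W12_norm_square:
  assumes "open \<Omega>" "f \<in> W12 \<Omega>"
  shows "(W12_norm \<Omega> f)\<^sup>2 = (LINT x|lebesgue_on \<Omega>. (f x)\<^sup>2)
    + (\<Sum>i\<in>UNIV. LINT x|lebesgue_on \<Omega>. (weak_partial \<Omega> i f x)\<^sup>2)"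
proof -
  have "(norm (weak_grad \<Omega> f x))\<^sup>2 = (\<Sum>i\<in>UNIV. (weak_partial \<Omega> i f x)\<^sup>2)" for x
    by (simp add: norm_vec_def L2_set_def weak_grad_def sum_nonneg)
  then have "(LINT x|lebesgue_on \<Omega>. (norm (weak_grad \<Omega> f x))\<^sup>2)
      = (\<Sum>i\<in>UNIV. LINT x|lebesgue_on \<Omega>. (weak_partial \<Omega> i f x)\<^sup>2)"
    using L2_square_integrable[OF W12_weak_partial(2)[OF assms]] by simp
  then show ?thesis by (simp add: W12_norm_def sum_nonneg)
qed

text \<open>
Splits convergence in the Sobolev norm into convergence of the functions and of each partial
derivative, with the classical derivatives of the approximating test functions.
\<close>

lemma W12_0_approximation:
  assumes "open \<Omega>" "w \<in> W12_0 \<Omega>"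
  obtains \<phi> where "\<And>n. \<phi> n \<in> test_functions \<Omega>"
    "(\<lambda>n. LINT x|lebesgue_on \<Omega>. (w x - \<phi> n x)\<^sup>2) \<longlonglongrightarrow> 0"
    "\<And>i. (\<lambda>n. LINT x|lebesgue_on \<Omega>. (weak_partial \<Omega> i w x - partial_deriv i (\<phi> n) x)\<^sup>2) \<longlonglongrightarrow> 0"
proof -
  obtain \<phi> where \<phi>: "\<And>n. \<phi> n \<in> test_functions \<Omega>"
    "(\<lambda>n. W12_norm \<Omega> (\<lambda>x. w x - \<phi> n x)) \<longlonglongrightarrow> 0"
    using assms(2) by (auto simp: W12_0_def)
  have w: "w \<in> W12 \<Omega>" using assms(2) by (simp add: W12_0_def)
  have diff: "(\<lambda>x. w x - \<phi> n x) \<in> W12 \<Omega>" for n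
    using W12_lincomb(1)[OF assms(1) w test_functions_W12(1)[OF assms(1) \<phi>(1)], of 1 "-1"] by simp
  have lim: "(\<lambda>n. (W12_norm \<Omega> (\<lambda>x. w x - \<phi> n x))\<^sup>2) \<longlonglongrightarrow> 0"
    using tendsto_power[OF \<phi>(2), of 2] by simp
  have eq: "(W12_norm \<Omega> (\<lambda>x. w x - \<phi> n x))\<^sup>2 = (LINT x|lebesgue_on \<Omega>. (w x - \<phi> n x)\<^sup>2)
    + (\<Sum>i\<in>UNIV. LINT x|lebesgue_on \<Omega>. (weak_partial \<Omega> i w x - partial_deriv i (\<phi> n) x)\<^sup>2)" for n
  proof -
    have "(LINT x|lebesgue_on \<Omega>. (weak_partial \<Omega> i (\<lambda>x. w x - \<phi> n x) x)\<^sup>2)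
      = (LINT x|lebesgue_on \<Omega>. (weak_partial \<Omega> i w x - partial_deriv i (\<phi> n) x)\<^sup>2)" for i
    proof (rule integral_cong_AE)
      have m: "weak_partial \<Omega> i f \<in> borel_measurable (lebesgue_on \<Omega>)" if "f \<in> W12 \<Omega>" for f
        using W12_weak_partial(2)[OF assms(1) that] by (rule L2_measurable)
      have m': "partial_deriv i (\<phi> n) \<in> borel_measurable (lebesgue_on \<Omega>)"
        by (intro L2_measurable test_functions_L2 assms(1) test_functions_partial_deriv \<phi>)
      show "(\<lambda>x. (weak_partial \<Omega> i (\<lambda>x. w x - \<phi> n x) x)\<^sup>2) \<in> borel_measurable (lebesgue_on \<Omega>)"
        using m[OF diff] by (intro borel_measurable_power)
      show "(\<lambda>x. (weak_partial \<Omega> i w x - partial_deriv i (\<phi> n) x)\<^sup>2) \<in> borel_measurable (lebesgue_on \<Omega>)"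
        using m[OF w] m' by (intro borel_measurable_power borel_measurable_diff)
      show "AE x in lebesgue_on \<Omega>. (weak_partial \<Omega> i (\<lambda>x. w x - \<phi> n x) x)\<^sup>2
          = (weak_partial \<Omega> i w x - partial_deriv i (\<phi> n) x)\<^sup>2"
        using W12_lincomb(2)[OF assms(1) w test_functions_W12(1)[OF assms(1) \<phi>(1)], of i 1 "-1" n]
          test_functions_W12(2)[OF assms(1) \<phi>(1)[of n], of i]
        by eventually_elim simp
    qed
    then show ?thesis by (simp add: W12_norm_square[OF assms(1) diff])
  qed
  show ?thesis
  proof
    show "\<phi> n \<in> test_functions \<Omega>" for n by (rule \<phi>(1))
    show "(\<lambda>n. LINT x|lebesgue_on \<Omega>. (w x - \<phi> n x)\<^sup>2) \<longlonglongrightarrow> 0"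
      by (rule tendsto_sandwich[OF _ _ tendsto_const lim]) (auto simp: eq sum_nonneg)
    fix i
    have "(LINT x|lebesgue_on \<Omega>. (weak_partial \<Omega> i w x - partial_deriv i (\<phi> n) x)\<^sup>2)
        \<le> (W12_norm \<Omega> (\<lambda>x. w x - \<phi> n x))\<^sup>2" for n
      unfolding eq by (rule order_trans[OF member_le_sum[of i UNIV]]) auto
    then show "(\<lambda>n. LINT x|lebesgue_on \<Omega>. (weak_partial \<Omega> i w x - partial_deriv i (\<phi> n) x)\<^sup>2) \<longlonglongrightarrow> 0"
      by (intro tendsto_sandwich[OF _ _ tendsto_const lim]) auto
  qed
qed

lemma W12_scale:
  assumes "open \<Omega>" "f \<in> W12 \<Omega>"
  shows "(\<lambda>x. c * f x) \<in> W12 \<Omega>" "(W12_norm \<Omega> (\<lambda>x. c * f x))\<^sup>2 = c\<^sup>2 * (W12_norm \<Omega> f)\<^sup>2"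
proof -
  show cf: "(\<lambda>x. c * f x) \<in> W12 \<Omega>"
    using W12_lincomb(1)[OF assms assms(2), of c 0] by simp
  have "(LINT x|lebesgue_on \<Omega>. (weak_partial \<Omega> i (\<lambda>x. c * f x) x)\<^sup>2)
      = (LINT x|lebesgue_on \<Omega>. c\<^sup>2 * (weak_partial \<Omega> i f x)\<^sup>2)" for i
    using W12_lincomb(2)[OF assms assms(2), of i c 0]
      L2_measurable[OF W12_weak_partial(2)[OF assms(1) cf, of i]] L2_measurable[OF W12_weak_partial(2)[OF assms, of i]]
    by (intro integral_cong_AE) (auto simp: power_mult_distrib)
  then show "(W12_norm \<Omega> (\<lambda>x. c * f x))\<^sup>2 = c\<^sup>2 * (W12_norm \<Omega> f)\<^sup>2"
    by (simp add: W12_norm_square[OF assms(1) cf] W12_norm_square[OF assms] power_mult_distrib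
      distrib_left sum_distrib_left)
qed

lemma W12_0_scale:
  assumes "open \<Omega>" "w \<in> W12_0 \<Omega>"
  shows "(\<lambda>x. c * w x) \<in> W12_0 \<Omega>"
proof -
  obtain \<phi> where \<phi>: "\<And>n. \<phi> n \<in> test_functions \<Omega>"
    "(\<lambda>n. W12_norm \<Omega> (\<lambda>x. w x - \<phi> n x)) \<longlonglongrightarrow> 0"
    using assms(2) by (auto simp: W12_0_def)
  have w: "w \<in> W12 \<Omega>" using assms(2) by (simp add: W12_0_def)
  have diff: "(\<lambda>x. w x - \<phi> n x) \<in> W12 \<Omega>" for n
    using W12_lincomb(1)[OF assms(1) w test_functions_W12(1)[OF assms(1) \<phi>(1)], of 1 "-1"] by simp
  have nn: "0 \<le> W12_norm \<Omega> f" for f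
    by (simp add: W12_norm_def)
  have "W12_norm \<Omega> (\<lambda>x. c * w x - c * \<phi> n x) = \<bar>c\<bar> * W12_norm \<Omega> (\<lambda>x. w x - \<phi> n x)" for n
  proof (rule power2_eq_imp_eq)
    show "(W12_norm \<Omega> (\<lambda>x. c * w x - c * \<phi> n x))\<^sup>2 = (\<bar>c\<bar> * W12_norm \<Omega> (\<lambda>x. w x - \<phi> n x))\<^sup>2"
      using W12_scale(2)[OF assms(1) diff, of c n] by (simp add: power_mult_distrib right_diff_distrib)
  qed (auto simp: nn)
  moreover have "(\<lambda>n. \<bar>c\<bar> * W12_norm \<Omega> (\<lambda>x. w x - \<phi> n x)) \<longlonglongrightarrow> 0"
    using tendsto_mult[OF tendsto_const \<phi>(2)] by simp
  moreover have "(\<lambda>x. c * \<phi> n x) \<in> test_functions \<Omega>" for n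
    by (intro test_functions_mult \<phi> C_diff_const)
  ultimately show ?thesis
    using W12_scale(1)[OF assms(1) w] unfolding W12_0_def
    by (auto intro!: exI[of _ "\<lambda>n x. c * \<phi> n x"])
qed

section \<open>Integrability of the area density\<close>

lemma L2_integrable:
  assumes "bounded \<Omega>" "open \<Omega>" "f \<in> L2 \<Omega>"
  shows "integrable (lebesgue_on \<Omega>) f"
proof -
  have "\<Omega> \<in> lmeasurable" using assms by (simp add: lmeasurable_open)
  then interpret finite_measure "lebesgue_on \<Omega>" by (rule finite_measure_lebesgue_on)
  have "(\<lambda>x. 1) \<in> L2 \<Omega>" by (simp add: L2_def)
  from L2_mult_integrable[OF assms(3) this] show ?thesis by simp
qed

lemma L2_vec_norm_integrable:
  fixes A :: "real ^ 'm::finite \<Rightarrow> real ^ 'm"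
  assumes "bounded \<Omega>" "open \<Omega>" "\<And>i. (\<lambda>x. A x $ i) \<in> L2 \<Omega>"
  shows "integrable (lebesgue_on \<Omega>) (\<lambda>x. norm (A x))"
proof (rule Bochner_Integration.integrable_bound)
  show "integrable (lebesgue_on \<Omega>) (\<lambda>x. \<Sum>i\<in>UNIV. \<bar>A x $ i\<bar>)"
    using assms by (intro Bochner_Integration.integrable_sum integrable_abs L2_integrable)
  show "(\<lambda>x. norm (A x)) \<in> borel_measurable (lebesgue_on \<Omega>)"
  proof -
    have [measurable]: "(\<lambda>x. A x $ i) \<in> borel_measurable (lebesgue_on \<Omega>)" for i
      using assms(3) by (rule L2_measurable)
    show ?thesis
      unfolding norm_vec_def L2_set_def real_norm_def power2_abs by measurable
  qed
  show "AE x in lebesgue_on \<Omega>. norm (norm (A x)) \<le> norm (\<Sum>i\<in>UNIV. \<bar>A x $ i\<bar>)"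
    using norm_le_l1_cart by (auto simp: sum_nonneg)
qed

lemma Linfty_mult_L2_integrable:
  assumes "bounded \<Omega>" "open \<Omega>" "H \<in> Linfty \<Omega>" "f \<in> L2 \<Omega>"
  shows "integrable (lebesgue_on \<Omega>) (\<lambda>x. H x * f x)"
proof -
  obtain C where C: "AE x in lebesgue_on \<Omega>. \<bar>H x\<bar> \<le> C"
    using assms(3) by (auto simp: Linfty_def)
  show ?thesis
  proof (rule Bochner_Integration.integrable_bound)
    show "integrable (lebesgue_on \<Omega>) (\<lambda>x. C * f x)"
      using assms by (intro integrable_mult_right L2_integrable) auto
    show "(\<lambda>x. H x * f x) \<in> borel_measurable (lebesgue_on \<Omega>)"
      using assms by (intro borel_measurable_times) (auto simp: Linfty_def L2_def)
    show "AE x in lebesgue_on \<Omega>. norm (H x * f x) \<le> norm (C * f x)"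
      using C by eventually_elim (auto simp: abs_mult intro!: mult_right_mono)
  qed
qed

lemma p_area_integrable:
  fixes \<Omega> :: "(real ^ 'm::finite) set"
  assumes "bounded \<Omega>" "open \<Omega>" "H \<in> Linfty \<Omega>" "\<And>k. (\<lambda>x. F x $ k) \<in> L2 \<Omega>" "f \<in> W12 \<Omega>"
  shows "(\<lambda>x. (weak_grad \<Omega> f x + F x) $ k) \<in> L2 \<Omega>"
    and "integrable (lebesgue_on \<Omega>) (\<lambda>x. norm (weak_grad \<Omega> f x + F x))"
    and "integrable (lebesgue_on \<Omega>) (\<lambda>x. H x * f x)"
proof -
  show L2: "(\<lambda>x. (weak_grad \<Omega> f x + F x) $ k) \<in> L2 \<Omega>" for k
    using L2_lincomb[OF W12_weak_partial(2)[OF assms(2,5), of k] assms(4)[of k], of 1 1]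
    by (simp add: weak_grad_def)
  show "integrable (lebesgue_on \<Omega>) (\<lambda>x. norm (weak_grad \<Omega> f x + F x))"
    by (intro L2_vec_norm_integrable assms L2)
  show "integrable (lebesgue_on \<Omega>) (\<lambda>x. H x * f x)"
    by (intro Linfty_mult_L2_integrable assms W12_L2)
qed

section \<open>Skew matrices\<close>

lemma skew_inner_zero:
  fixes a :: "real ^ 'm::finite ^ 'm"
  assumes "\<And>j k. a $ j $ k + a $ k $ j = 0"
  shows "x \<bullet> (a *v x) = 0"
proof -
  have "x \<bullet> (a *v x) = (\<Sum>j\<in>UNIV. \<Sum>k\<in>UNIV. a $ j $ k * (x $ j * x $ k))"
    by (simp add: inner_vec_def matrix_vector_mult_def sum_distrib_left mult_ac)
  also have "\<dots> = (\<Sum>k\<in>UNIV. \<Sum>j\<in>UNIV. a $ j $ k * (x $ j * x $ k))"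
    by (rule sum.swap)
  also have "\<dots> = (\<Sum>k\<in>UNIV. \<Sum>j\<in>UNIV. - (a $ k $ j * (x $ k * x $ j)))"
    using assms by (intro sum.cong refl) (simp add: eq_neg_iff_add_eq_0 mult.commute flip: distrib_right)
  also have "\<dots> = - (x \<bullet> (a *v x))"
    by (simp add: inner_vec_def matrix_vector_mult_def sum_distrib_left mult_ac sum_negf)
  finally show ?thesis by simp
qed

text \<open>
Equality in the triangle inequality makes \<open>x\<close> and \<open>y\<close> parallel, and a skew matrix maps a vector to one that is
orthogonal to all its multiples. The case \<open>x = 0\<close> occurs on the singular set of a minimizer.
\<close>

lemma norm_add_eq_imp_skew_orthogonal:
  fixes a :: "real ^ 'm::finite ^ 'm"
  assumes skew: "\<And>j k. a $ j $ k + a $ k $ j = 0" and eq: "norm (x + y) = norm x + norm y"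
  shows "(x - y) \<bullet> (a *v x) = 0"
proof (cases "x = 0")
  case False
  have "norm x *\<^sub>R y = norm y *\<^sub>R x"
    using eq norm_triangle_eq by metis
  then have "norm x * (y \<bullet> (a *v x)) = norm y * (x \<bullet> (a *v x))"
    by (metis inner_scaleR_left)
  then have "y \<bullet> (a *v x) = 0"
    using False skew_inner_zero[OF skew] by simp
  then show ?thesis
    using skew_inner_zero[OF skew] by (simp add: inner_diff_left)
qed simp

section \<open>Two minimizers\<close>

text \<open>
The functional is convex, because its area part is convex and its \<open>H\<close> part linear. The midpoint \<open>m\<close> of
\<open>u\<close> and \<open>v\<close> is a competitor for both, so its value at \<open>m\<close> is at least the mean of those at \<open>u\<close> and \<open>v\<close>; the reverse inequality holds
for the integrands pointwise, by the triangle inequality. Hence equality holds almost everywhere.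
\<close>

lemma minimizers_norm_add:
  fixes \<Omega> :: "(real ^ 'm::finite) set"
  assumes \<Omega>: "bounded \<Omega>" "open \<Omega>" and H: "H \<in> Linfty \<Omega>" and F: "\<And>k. (\<lambda>x. F x $ k) \<in> L2 \<Omega>"
    and u: "p_area_minimizer \<Omega> F H u" and v: "p_area_minimizer \<Omega> F H v"
    and uv: "(\<lambda>x. u x - v x) \<in> W12_0 \<Omega>"
  shows "AE x in lebesgue_on \<Omega>. norm ((weak_grad \<Omega> u x + F x) + (weak_grad \<Omega> v x + F x))
     = norm (weak_grad \<Omega> u x + F x) + norm (weak_grad \<Omega> v x + F x)"
proof -
  let ?A = "\<lambda>x. weak_grad \<Omega> u x + F x" and ?B = "\<lambda>x. weak_grad \<Omega> v x + F x"
  define m where "m x = (1/2) * u x + (1/2) * v x" for x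
  let ?M = "\<lambda>x. weak_grad \<Omega> m x + F x"
  have W: "u \<in> W12 \<Omega>" "v \<in> W12 \<Omega>" using u v by (auto simp: p_area_minimizer_def)
  have m: "m \<in> W12 \<Omega>" unfolding m_def using W by (intro W12_lincomb \<Omega>)
  note intu = p_area_integrable[OF \<Omega> H F W(1)] and intv = p_area_integrable[OF \<Omega> H F W(2)]
    and intm = p_area_integrable[OF \<Omega> H F m]
  have "AE x in lebesgue_on \<Omega>. \<forall>i. weak_partial \<Omega> i m x = (1/2) * weak_partial \<Omega> i u x + (1/2) * weak_partial \<Omega> i v x"
    unfolding m_def AE_all_countable by (intro allI W12_lincomb(2)[OF \<Omega>(2) W])
  then have M: "AE x in lebesgue_on \<Omega>. 2 *\<^sub>R ?M x = ?A x + ?B x"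
    by eventually_elim (simp add: vec_eq_iff weak_grad_def algebra_simps)
  have intAB: "integrable (lebesgue_on \<Omega>) (\<lambda>x. norm (?A x + ?B x))"
  proof (intro L2_vec_norm_integrable \<Omega>)
    show "(\<lambda>x. (?A x + ?B x) $ i) \<in> L2 \<Omega>" for i
      using L2_lincomb[OF intu(1)[of i] intv(1)[of i], of 1 1] by simp
  qed
  have AB: "(LINT x|lebesgue_on \<Omega>. norm (?A x + ?B x)) = 2 * (LINT x|lebesgue_on \<Omega>. norm (?M x))"
  proof -
    have "(LINT x|lebesgue_on \<Omega>. norm (?A x + ?B x)) = (LINT x|lebesgue_on \<Omega>. 2 * norm (?M x))"
    proof (rule integral_cong_AE)
      show "AE x in lebesgue_on \<Omega>. norm (?A x + ?B x) = 2 * norm (?M x)"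
        using M
      proof eventually_elim
        case (elim x)
        then show ?case using norm_scaleR[of 2 "?M x"] by simp
      qed
    qed (use intAB intm(2) in auto)
    then show ?thesis by simp
  qed
  have "p_area \<Omega> F H u \<le> p_area \<Omega> F H m"
  proof -
    \<comment> \<open>The midpoint, reached from \<open>u\<close> and below from \<open>v\<close>, differs from both by a multiple of \<open>u - v\<close>.\<close>
    have "(\<lambda>x. (-1/2) * (u x - v x)) \<in> W12_0 \<Omega>"
      by (rule W12_0_scale[OF \<Omega>(2) uv])
    moreover have "(\<lambda>x. u x + (-1/2) * (u x - v x)) = m"
      by (auto simp: m_def fun_eq_iff field_simps)
    ultimately show ?thesis using u unfolding p_area_minimizer_def by metis
  qed
  moreover have "p_area \<Omega> F H v \<le> p_area \<Omega> F H m"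
  proof -
    have "(\<lambda>x. (1/2) * (u x - v x)) \<in> W12_0 \<Omega>"
      by (rule W12_0_scale[OF \<Omega>(2) uv])
    moreover have "(\<lambda>x. v x + (1/2) * (u x - v x)) = m"
      by (auto simp: m_def fun_eq_iff field_simps)
    ultimately show ?thesis using v unfolding p_area_minimizer_def by metis
  qed
  moreover have "p_area \<Omega> F H u = (LINT x|lebesgue_on \<Omega>. norm (?A x)) + (LINT x|lebesgue_on \<Omega>. H x * u x)"
    unfolding p_area_def by (rule Bochner_Integration.integral_add[OF intu(2,3)])
  moreover have "p_area \<Omega> F H v = (LINT x|lebesgue_on \<Omega>. norm (?B x)) + (LINT x|lebesgue_on \<Omega>. H x * v x)"
    unfolding p_area_def by (rule Bochner_Integration.integral_add[OF intv(2,3)])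
  moreover have "p_area \<Omega> F H m = (LINT x|lebesgue_on \<Omega>. norm (?M x)) + (LINT x|lebesgue_on \<Omega>. H x * m x)"
    unfolding p_area_def by (rule Bochner_Integration.integral_add[OF intm(2,3)])
  moreover have "2 * (LINT x|lebesgue_on \<Omega>. H x * m x)
      = (LINT x|lebesgue_on \<Omega>. H x * u x) + (LINT x|lebesgue_on \<Omega>. H x * v x)"
  proof -
    have "2 * (LINT x|lebesgue_on \<Omega>. H x * m x) = (LINT x|lebesgue_on \<Omega>. H x * u x + H x * v x)"
      unfolding m_def integral_mult_right_zero[symmetric]
      by (rule arg_cong[where f = "integral\<^sup>L _"]) (auto simp: algebra_simps fun_eq_iff)
    then show ?thesis using intu(3) intv(3) by simp
  qed
  ultimately have "(LINT x|lebesgue_on \<Omega>. norm (?A x)) + (LINT x|lebesgue_on \<Omega>. norm (?B x))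
     \<le> (LINT x|lebesgue_on \<Omega>. norm (?A x + ?B x))"
    using AB by linarith
  moreover have defect: "integrable (lebesgue_on \<Omega>) (\<lambda>x. norm (?A x) + norm (?B x) - norm (?A x + ?B x))"
    using intu(2) intv(2) intAB by (intro Bochner_Integration.integrable_add Bochner_Integration.integrable_diff)
  moreover have "(LINT x|lebesgue_on \<Omega>. norm (?A x) + norm (?B x) - norm (?A x + ?B x))
     = (LINT x|lebesgue_on \<Omega>. norm (?A x)) + (LINT x|lebesgue_on \<Omega>. norm (?B x)) - (LINT x|lebesgue_on \<Omega>. norm (?A x + ?B x))"
    using intu(2) intv(2) intAB by simp
  moreover have nn: "0 \<le> norm (?A x) + norm (?B x) - norm (?A x + ?B x)" for x
    using norm_triangle_ineq[of "?A x" "?B x"] by simp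
  then have "0 \<le> (LINT x|lebesgue_on \<Omega>. norm (?A x) + norm (?B x) - norm (?A x + ?B x))"
    by (intro Bochner_Integration.integral_nonneg)
  ultimately have "(LINT x|lebesgue_on \<Omega>. norm (?A x) + norm (?B x) - norm (?A x + ?B x)) = 0"
    by linarith
  then have "AE x in lebesgue_on \<Omega>. norm (?A x) + norm (?B x) - norm (?A x + ?B x) = 0"
    using integral_nonneg_eq_0_iff_AE[OF defect] nn by simp
  then show ?thesis by eventually_elim simp
qed

section \<open>Divergences of rotated vector fields\<close>

text \<open>
Integrating by parts moves the weak derivative of \<open>f\<close> to \<open>\<psi>\<close>, and the contraction of a
skew matrix with the symmetric matrix of second derivatives of \<open>\<psi>\<close> vanishes.
\<close>

lemma skew_gradient_divergence_free:
  fixes \<Omega> :: "(real ^ 'm::finite) set"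
  assumes "open \<Omega>" "f \<in> W12 \<Omega>" and skew: "\<And>j k. a $ j $ k + a $ k $ j = 0"
    and \<psi>: "\<psi> \<in> test_functions \<Omega>"
  shows "(LINT x|lebesgue_on \<Omega>. (\<Sum>j\<in>UNIV. partial_deriv j \<psi> x * (a *v weak_grad \<Omega> f x) $ j)) = 0"
proof -
  let ?I = "\<lambda>j k. LINT x|lebesgue_on \<Omega>. f x * partial_deriv k (partial_deriv j \<psi>) x"
  note wp = W12_weak_partial[OF assms(1,2)]
  have int: "integrable (lebesgue_on \<Omega>) (\<lambda>x. weak_partial \<Omega> k f x * partial_deriv j \<psi> x)" for j k
    by (intro L2_mult_integrable wp(2) test_functions_L2[OF assms(1)] test_functions_partial_deriv[OF \<psi>])
  have "(LINT x|lebesgue_on \<Omega>. (\<Sum>j\<in>UNIV. partial_deriv j \<psi> x * (a *v weak_grad \<Omega> f x) $ j))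
     = (LINT x|lebesgue_on \<Omega>. (\<Sum>j\<in>UNIV. \<Sum>k\<in>UNIV. a $ j $ k * (weak_partial \<Omega> k f x * partial_deriv j \<psi> x)))"
    by (simp add: matrix_vector_mult_def weak_grad_def sum_distrib_left mult_ac)
  also have "\<dots> = (\<Sum>j\<in>UNIV. \<Sum>k\<in>UNIV. a $ j $ k * (LINT x|lebesgue_on \<Omega>. weak_partial \<Omega> k f x * partial_deriv j \<psi> x))"
    using int by simp
  also have "\<dots> = (\<Sum>j\<in>UNIV. \<Sum>k\<in>UNIV. - (a $ j $ k * ?I j k))"
    using wp(1) test_functions_partial_deriv[OF \<psi>] by (simp add: has_weak_partial_def)
  finally have eq: "(LINT x|lebesgue_on \<Omega>. (\<Sum>j\<in>UNIV. partial_deriv j \<psi> x * (a *v weak_grad \<Omega> f x) $ j))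
     = - (\<Sum>j\<in>UNIV. \<Sum>k\<in>UNIV. a $ j $ k * ?I j k)" by (simp add: sum_negf)
  have sym: "?I j k = ?I k j" for j k
    using partial_deriv_commute[OF test_functions_C_diff[OF \<psi>]] by simp
  have anti: "a $ j $ k * ?I j k = - (a $ k $ j * ?I k j)" for j k
  proof -
    have "a $ j $ k = - a $ k $ j" using skew[of j k] by linarith
    then show ?thesis unfolding sym[of j k] by simp
  qed
  have "(\<Sum>j\<in>UNIV. \<Sum>k\<in>UNIV. a $ j $ k * ?I j k) = (\<Sum>k\<in>UNIV. \<Sum>j\<in>UNIV. a $ j $ k * ?I j k)"
    by (rule sum.swap)
  also have "\<dots> = (\<Sum>k\<in>UNIV. \<Sum>j\<in>UNIV. - (a $ k $ j * ?I k j))"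
    using anti by (intro sum.cong refl) blast
  also have "\<dots> = - (\<Sum>j\<in>UNIV. \<Sum>k\<in>UNIV. a $ j $ k * ?I j k)"
    by (simp add: sum_negf)
  finally show ?thesis using eq by simp
qed

lemma flat_W12:
  fixes \<Omega> :: "(real ^ 'm::finite) set"
  assumes "open \<Omega>" "\<And>k. (\<lambda>x. F x $ k) \<in> W12 \<Omega>"
  shows "(\<lambda>x. flat a F x $ j) \<in> W12 \<Omega>"
proof -
  have zero: "(\<lambda>x. 0) \<in> W12 \<Omega>"
    using W12_scale(1)[OF assms(1) assms(2)[of undefined], of 0] by simp
  have "(\<lambda>x. \<Sum>k\<in>I. a $ j $ k * F x $ k) \<in> W12 \<Omega>" if "finite I" for I
    using that
  proof (induction I rule: finite_induct)
    case (insert k I)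
    then show ?case
      using W12_lincomb(1)[OF assms(1) assms(2)[of k] insert.IH, of "a $ j $ k" 1] by simp
  qed (simp add: zero)
  then show ?thesis by (simp add: flat_def matrix_vector_mult_def)
qed

text \<open>
The gradient part of the rotated field contributes nothing to the divergence, so only
the divergence of the rotated \<open>F\<close> remains.
\<close>

lemma integral_gradient_test_flat:
  fixes \<Omega> :: "(real ^ 'm::finite) set"
  assumes "open \<Omega>" "f \<in> W12 \<Omega>" and F: "\<And>k. (\<lambda>x. F x $ k) \<in> W12 \<Omega>"
    and skew: "\<And>j k. a $ j $ k + a $ k $ j = 0" and \<psi>: "\<psi> \<in> test_functions \<Omega>"
  shows "(LINT x|lebesgue_on \<Omega>. (\<Sum>j\<in>UNIV. partial_deriv j \<psi> x * (a *v (weak_grad \<Omega> f x + F x)) $ j))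
     = - (LINT x|lebesgue_on \<Omega>. \<psi> x * weak_div \<Omega> (flat a F) x)"
proof -
  note G = flat_W12[OF assms(1) F]
  have L2\<psi>: "partial_deriv j \<psi> \<in> L2 \<Omega>" "\<psi> \<in> L2 \<Omega>" for j
    by (intro test_functions_L2[OF assms(1)] test_functions_partial_deriv \<psi>)+
  have grad: "(\<lambda>x. (a *v weak_grad \<Omega> f x) $ j) \<in> L2 \<Omega>" for j
  proof -
    have "(\<lambda>x. \<Sum>k\<in>UNIV. a $ j $ k * weak_partial \<Omega> k f x) \<in> L2 \<Omega>"
      by (intro L2_sum finite W12_weak_partial(2) assms(1,2))
    then show ?thesis by (simp add: matrix_vector_mult_def weak_grad_def)
  qed
  have int: "integrable (lebesgue_on \<Omega>) (\<lambda>x. partial_deriv j \<psi> x * (a *v weak_grad \<Omega> f x) $ j)"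
    "integrable (lebesgue_on \<Omega>) (\<lambda>x. partial_deriv j \<psi> x * flat a F x $ j)"
    "integrable (lebesgue_on \<Omega>) (\<lambda>x. \<psi> x * weak_partial \<Omega> j (\<lambda>y. flat a F y $ j) x)" for j
    using W12_L2[OF G] W12_weak_partial(2)[OF assms(1) G]
    by (auto intro!: L2_mult_integrable L2\<psi> grad)
  have "(LINT x|lebesgue_on \<Omega>. (\<Sum>j\<in>UNIV. partial_deriv j \<psi> x * (a *v (weak_grad \<Omega> f x + F x)) $ j))
     = (LINT x|lebesgue_on \<Omega>. (\<Sum>j\<in>UNIV. partial_deriv j \<psi> x * (a *v weak_grad \<Omega> f x) $ j)
         + (\<Sum>j\<in>UNIV. partial_deriv j \<psi> x * flat a F x $ j))"
    by (simp add: flat_def matrix_vector_right_distrib distrib_left sum.distrib)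
  also have "\<dots> = (LINT x|lebesgue_on \<Omega>. (\<Sum>j\<in>UNIV. partial_deriv j \<psi> x * (a *v weak_grad \<Omega> f x) $ j))
         + (LINT x|lebesgue_on \<Omega>. (\<Sum>j\<in>UNIV. partial_deriv j \<psi> x * flat a F x $ j))"
    by (intro Bochner_Integration.integral_add Bochner_Integration.integrable_sum int)
  also have "(LINT x|lebesgue_on \<Omega>. (\<Sum>j\<in>UNIV. partial_deriv j \<psi> x * (a *v weak_grad \<Omega> f x) $ j)) = 0"
    by (rule skew_gradient_divergence_free[OF assms(1,2) skew \<psi>])
  also have "(LINT x|lebesgue_on \<Omega>. (\<Sum>j\<in>UNIV. partial_deriv j \<psi> x * flat a F x $ j))
     = (\<Sum>j\<in>UNIV. LINT x|lebesgue_on \<Omega>. flat a F x $ j * partial_deriv j \<psi> x)"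
    using int(2) by (simp add: mult.commute)
  also have "\<dots> = (\<Sum>j\<in>UNIV. - (LINT x|lebesgue_on \<Omega>. \<psi> x * weak_partial \<Omega> j (\<lambda>y. flat a F y $ j) x))"
    using W12_weak_partial(1)[OF assms(1) G] \<psi> by (simp add: has_weak_partial_def mult.commute)
  also have "\<dots> = - (LINT x|lebesgue_on \<Omega>. \<psi> x * weak_div \<Omega> (flat a F) x)"
    using int(3) by (simp add: weak_div_def sum_distrib_left sum_negf)
  finally show ?thesis by simp
qed

lemma L2_saturation:
  assumes "f \<in> L2 \<Omega>"
  shows "(\<lambda>x. saturation (f x)) \<in> L2 \<Omega>"
proof (rule L2_bounded_by[OF assms])
  show "(\<lambda>x. saturation (f x)) \<in> borel_measurable (lebesgue_on \<Omega>)"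
    using L2_measurable[OF assms] borel_measurable_saturation(1) by (rule measurable_compose)
  show "\<bar>saturation (f x)\<bar> \<le> \<bar>f x\<bar>" for x
    using saturation_Lipschitz[of "f x" 0] saturation_eq_0_iff[of 0] by simp
qed

section \<open>Uniqueness\<close>

text \<open>
The assumption \<open>weak_div\<close> says that \<open>d\<close> is the divergence of \<open>N\<close>. Formally, one tests it with \<open>saturation w\<close>, whose
gradient is a multiple of the gradient of \<open>w\<close> and hence orthogonal to \<open>N\<close>. As \<open>saturation w\<close> is
not a test function, the identity is used for \<open>saturation \<phi>\<^sub>n\<close> with test functions \<open>\<phi>\<^sub>n\<close> tending to \<open>w\<close>. The
orthogonality then allows replacing \<open>\<nabla>\<phi>\<^sub>n\<close> by \<open>\<nabla>\<phi>\<^sub>n - \<nabla>w\<close>, which tends to \<open>0\<close> in the mean square; the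
factor \<open>saturation' \<phi>\<^sub>n\<close> is bounded by \<open>1\<close>.
\<close>

lemma integral_saturation_eq_0:
  fixes \<Omega> :: "(real ^ 'm::finite) set" and N :: "real ^ 'm \<Rightarrow> real ^ 'm"
  assumes "open \<Omega>" and w0: "w \<in> W12_0 \<Omega>"
    and N: "\<And>j. (\<lambda>x. N x $ j) \<in> L2 \<Omega>" and D: "d \<in> L2 \<Omega>"
    and orth: "AE x in lebesgue_on \<Omega>. (\<Sum>j\<in>UNIV. weak_partial \<Omega> j w x * N x $ j) = 0"
    and weak_div: "\<And>\<psi>. \<psi> \<in> test_functions \<Omega> \<Longrightarrow>
      (LINT x|lebesgue_on \<Omega>. (\<Sum>j\<in>UNIV. partial_deriv j \<psi> x * N x $ j)) = - (LINT x|lebesgue_on \<Omega>. \<psi> x * d x)"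
  shows "(LINT x|lebesgue_on \<Omega>. saturation (w x) * d x) = 0"
proof -
  have w: "w \<in> W12 \<Omega>" using w0 by (simp add: W12_0_def)
  obtain \<phi> where \<phi>: "\<And>n. \<phi> n \<in> test_functions \<Omega>"
    and lim_w: "(\<lambda>n. LINT x|lebesgue_on \<Omega>. (w x - \<phi> n x)\<^sup>2) \<longlonglongrightarrow> 0"
    and lim_dw: "\<And>i. (\<lambda>n. LINT x|lebesgue_on \<Omega>. (weak_partial \<Omega> i w x - partial_deriv i (\<phi> n) x)\<^sup>2) \<longlonglongrightarrow> 0"
    using W12_0_approximation[OF \<open>open \<Omega>\<close> w0] by blast
  have \<phi>L2: "\<phi> n \<in> L2 \<Omega>" "partial_deriv i (\<phi> n) \<in> L2 \<Omega>" for n i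
    by (intro test_functions_L2[OF \<open>open \<Omega>\<close>] test_functions_partial_deriv \<phi>)+
  have diffL2: "(\<lambda>x. w x - \<phi> n x) \<in> L2 \<Omega>"
    "(\<lambda>x. weak_partial \<Omega> i w x - partial_deriv i (\<phi> n) x) \<in> L2 \<Omega>" for n i
    using L2_lincomb[OF W12_L2[OF w] \<phi>L2(1), of 1 "-1" n]
      L2_lincomb[OF W12_weak_partial(2)[OF \<open>open \<Omega>\<close> w] \<phi>L2(2), of 1 i "-1" i n] by simp_all
  note satL2 = L2_saturation[OF W12_L2[OF w]] L2_saturation[OF \<phi>L2(1)]
  note sat'_meas = measurable_compose[OF L2_measurable[OF \<phi>L2(1)] borel_measurable_saturation(2)]

  \<comment> \<open>The right-hand sides converge because the saturation is Lipschitz with constant \<open>1\<close>.\<close>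
  have rhs: "(\<lambda>n. LINT x|lebesgue_on \<Omega>. (saturation (w x) - saturation (\<phi> n x)) * d x) \<longlonglongrightarrow> 0"
  proof (rule integral_tendsto_0_L2_dominated[OF diffL2(1) lim_w D])
    show "(\<lambda>x. (saturation (w x) - saturation (\<phi> n x)) * d x) \<in> borel_measurable (lebesgue_on \<Omega>)" for n
      by (intro borel_measurable_times borel_measurable_diff L2_measurable satL2 D)
    show "AE x in lebesgue_on \<Omega>. \<bar>(saturation (w x) - saturation (\<phi> n x)) * d x\<bar> \<le> \<bar>(w x - \<phi> n x) * d x\<bar>" for n
      using saturation_Lipschitz by (auto simp: abs_mult intro!: mult_right_mono)
  qed
  \<comment> \<open>The left-hand sides, after subtracting the gradient of \<open>w\<close>, tend to \<open>0\<close>.\<close>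
  have lhs_summand: "(\<lambda>n. LINT x|lebesgue_on \<Omega>. saturation' (\<phi> n x) *
      ((weak_partial \<Omega> j w x - partial_deriv j (\<phi> n) x) * N x $ j)) \<longlonglongrightarrow> 0"
    and summand_int: "\<And>n. integrable (lebesgue_on \<Omega>) (\<lambda>x. saturation' (\<phi> n x) *
      ((weak_partial \<Omega> j w x - partial_deriv j (\<phi> n) x) * N x $ j))" for j
  proof -
    have meas: "(\<lambda>x. saturation' (\<phi> n x) * ((weak_partial \<Omega> j w x - partial_deriv j (\<phi> n) x) * N x $ j))
        \<in> borel_measurable (lebesgue_on \<Omega>)" for n
      by (intro borel_measurable_times sat'_meas L2_measurable[OF diffL2(2)] L2_measurable[OF N])
    have bound: "AE x in lebesgue_on \<Omega>. \<bar>saturation' (\<phi> n x) * ((weak_partial \<Omega> j w x - partial_deriv j (\<phi> n) x) * N x $ j)\<bar>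
        \<le> \<bar>(weak_partial \<Omega> j w x - partial_deriv j (\<phi> n) x) * N x $ j\<bar>" for n
      using saturation'_le_1 by (auto simp: abs_mult intro!: mult_left_le_one_le)
    show "(\<lambda>n. LINT x|lebesgue_on \<Omega>. saturation' (\<phi> n x) *
      ((weak_partial \<Omega> j w x - partial_deriv j (\<phi> n) x) * N x $ j)) \<longlonglongrightarrow> 0"
      by (rule integral_tendsto_0_L2_dominated[OF diffL2(2) lim_dw N meas bound])
    show "integrable (lebesgue_on \<Omega>) (\<lambda>x. saturation' (\<phi> n x) *
      ((weak_partial \<Omega> j w x - partial_deriv j (\<phi> n) x) * N x $ j))" for n
      using bound[of n] by (intro Bochner_Integration.integrable_bound[OF L2_mult_integrable[OF diffL2(2) N] meas]) simp
  qed
  have "(LINT x|lebesgue_on \<Omega>. saturation (\<phi> n x) * d x) = (\<Sum>j\<in>UNIV. LINT x|lebesgue_on \<Omega>.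
      saturation' (\<phi> n x) * ((weak_partial \<Omega> j w x - partial_deriv j (\<phi> n) x) * N x $ j))" for n
  proof -
    have "(LINT x|lebesgue_on \<Omega>. saturation (\<phi> n x) * d x)
       = - (LINT x|lebesgue_on \<Omega>. (\<Sum>j\<in>UNIV. partial_deriv j (\<lambda>x. saturation (\<phi> n x)) x * N x $ j))"
      unfolding weak_div[OF test_functions_saturation[OF \<phi>]] by simp
    also have "\<dots> = (LINT x|lebesgue_on \<Omega>. (\<Sum>j\<in>UNIV. - (partial_deriv j (\<lambda>x. saturation (\<phi> n x)) x * N x $ j)))"
      by (simp add: sum_negf)
    also have "\<dots> = (LINT x|lebesgue_on \<Omega>. (\<Sum>j\<in>UNIV. saturation' (\<phi> n x) *
        ((weak_partial \<Omega> j w x - partial_deriv j (\<phi> n) x) * N x $ j)))"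
    proof (rule integral_cong_AE)
      show "(\<lambda>x. \<Sum>j\<in>UNIV. - (partial_deriv j (\<lambda>x. saturation (\<phi> n x)) x * N x $ j)) \<in> borel_measurable (lebesgue_on \<Omega>)"
        by (intro borel_measurable_sum borel_measurable_uminus borel_measurable_times L2_measurable N
            test_functions_L2[OF \<open>open \<Omega>\<close>] test_functions_partial_deriv test_functions_saturation \<phi>)
      show "(\<lambda>x. \<Sum>j\<in>UNIV. saturation' (\<phi> n x) * ((weak_partial \<Omega> j w x - partial_deriv j (\<phi> n) x) * N x $ j))
          \<in> borel_measurable (lebesgue_on \<Omega>)"
        using summand_int by (intro borel_measurable_sum) auto
      show "AE x in lebesgue_on \<Omega>. (\<Sum>j\<in>UNIV. - (partial_deriv j (\<lambda>x. saturation (\<phi> n x)) x * N x $ j))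
         = (\<Sum>j\<in>UNIV. saturation' (\<phi> n x) * ((weak_partial \<Omega> j w x - partial_deriv j (\<phi> n) x) * N x $ j))"
        using orth
      proof eventually_elim
        case (elim x)
        have "(\<Sum>j\<in>UNIV. saturation' (\<phi> n x) * ((weak_partial \<Omega> j w x - partial_deriv j (\<phi> n) x) * N x $ j))
          = saturation' (\<phi> n x) * (\<Sum>j\<in>UNIV. weak_partial \<Omega> j w x * N x $ j)
            + (\<Sum>j\<in>UNIV. - (saturation' (\<phi> n x) * partial_deriv j (\<phi> n) x * N x $ j))"
          by (simp add: sum_distrib_left sum.distrib[symmetric] algebra_simps sum_subtractf)
        then show ?case
          using elim by (simp add: partial_deriv_saturation[OF \<phi>])
      qed
    qed
    also have "\<dots> = (\<Sum>j\<in>UNIV. LINT x|lebesgue_on \<Omega>.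
        saturation' (\<phi> n x) * ((weak_partial \<Omega> j w x - partial_deriv j (\<phi> n) x) * N x $ j))"
      using summand_int by (intro Bochner_Integration.integral_sum)
    finally show ?thesis .
  qed
  moreover have "(\<lambda>n. \<Sum>j\<in>UNIV. LINT x|lebesgue_on \<Omega>.
      saturation' (\<phi> n x) * ((weak_partial \<Omega> j w x - partial_deriv j (\<phi> n) x) * N x $ j)) \<longlonglongrightarrow> (\<Sum>j\<in>(UNIV::'m set). 0)"
    by (intro tendsto_sum lhs_summand)
  ultimately have "(\<lambda>n. LINT x|lebesgue_on \<Omega>. saturation (\<phi> n x) * d x) \<longlonglongrightarrow> 0" by simp
  from tendsto_add[OF rhs this]
  have "(\<lambda>n. LINT x|lebesgue_on \<Omega>. saturation (w x) * d x) \<longlonglongrightarrow> 0"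
    using L2_mult_integrable[OF satL2(1) D] L2_mult_integrable[OF satL2(2) D]
    by (simp add: left_diff_distrib)
  then show ?thesis
    by (simp add: LIMSEQ_const_iff)
qed

theorem theoremC:
  fixes \<Omega> :: "(real ^ 'm::finite) set"
    and H :: "real ^ 'm \<Rightarrow> real"
    and F :: "real ^ 'm \<Rightarrow> real ^ 'm"
    and a :: "real ^ 'm ^ 'm"
    and u v :: "real ^ 'm \<Rightarrow> real"
  assumes "open \<Omega>" and "connected \<Omega>" and "\<Omega> \<noteq> {}" and "bounded \<Omega>"
    and "H \<in> Linfty \<Omega>"
    and "\<And>k. (\<lambda>x. F x $ k) \<in> W12 \<Omega>"
    and "\<And>j k. a $ j $ k + a $ k $ j = 0"
    and "(AE x in lebesgue_on \<Omega>. weak_div \<Omega> (flat a F) x > 0) \<or>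
         (AE x in lebesgue_on \<Omega>. weak_div \<Omega> (flat a F) x < 0)"
    and "p_area_minimizer \<Omega> F H u" and "p_area_minimizer \<Omega> F H v"
    and "(\<lambda>x. u x - v x) \<in> W12_0 \<Omega>"
  shows "AE x in lebesgue_on \<Omega>. u x = v x"
proof -
  note F = assms(6) and skew = assms(7)
  let ?A = "\<lambda>x. weak_grad \<Omega> u x + F x" and ?B = "\<lambda>x. weak_grad \<Omega> v x + F x"
  let ?D = "weak_div \<Omega> (flat a F)"
  define w where "w x = u x - v x" for x
  have W: "u \<in> W12 \<Omega>" "v \<in> W12 \<Omega>" using assms(9,10) by (auto simp: p_area_minimizer_def)
  have w0: "w \<in> W12_0 \<Omega>" using assms(11) by (simp add: w_def[abs_def])
  then have w: "w \<in> W12 \<Omega>" by (simp add: W12_0_def)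
  note FL2 = W12_L2[OF F]
  define N where "N x = a *v ?A x" for x
  have N: "(\<lambda>x. N x $ j) \<in> L2 \<Omega>" for j
  proof -
    have "(\<lambda>x. \<Sum>k\<in>UNIV. a $ j $ k * (?A x $ k)) \<in> L2 \<Omega>"
      by (intro L2_sum finite p_area_integrable(1)[OF assms(4,1,5) FL2 W(1)])
    then show ?thesis by (simp add: N_def matrix_vector_mult_def)
  qed
  have D: "?D \<in> L2 \<Omega>"
  proof -
    have "(\<lambda>x. \<Sum>j\<in>UNIV. 1 * weak_partial \<Omega> j (\<lambda>y. flat a F y $ j) x) \<in> L2 \<Omega>"
      by (intro L2_sum finite W12_weak_partial(2) assms(1) flat_W12 F)
    then show ?thesis by (simp add: weak_div_def[abs_def])
  qed

  have grad_w: "AE x in lebesgue_on \<Omega>. \<forall>i. weak_partial \<Omega> i w x = weak_partial \<Omega> i u x - weak_partial \<Omega> i v x"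
    unfolding w_def[abs_def] using W12_lincomb(2)[OF assms(1) W, of _ 1 "-1"] by (simp add: AE_all_countable)
  have orth: "AE x in lebesgue_on \<Omega>. (\<Sum>j\<in>UNIV. weak_partial \<Omega> j w x * N x $ j) = 0"
    using minimizers_norm_add[OF assms(4,1,5) FL2 assms(9-11)] grad_w
  proof eventually_elim
    case (elim x)
    have "(?A x - ?B x) \<bullet> N x = 0"
      unfolding N_def by (rule norm_add_eq_imp_skew_orthogonal[OF skew elim(1)])
    then show ?case using elim(2) by (simp add: inner_vec_def weak_grad_def)
  qed

  have zero: "(LINT x|lebesgue_on \<Omega>. saturation (w x) * ?D x) = 0"
  proof (rule integral_saturation_eq_0[OF assms(1) w0 N D])
    show "AE x in lebesgue_on \<Omega>. (\<Sum>j\<in>UNIV. weak_partial \<Omega> j w x * N x $ j) = 0"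
      by (rule orth)
    show "(LINT x|lebesgue_on \<Omega>. (\<Sum>j\<in>UNIV. partial_deriv j \<psi> x * N x $ j))
        = - (LINT x|lebesgue_on \<Omega>. \<psi> x * ?D x)" if "\<psi> \<in> test_functions \<Omega>" for \<psi>
      unfolding N_def by (rule integral_gradient_test_flat[OF assms(1) W(1) F skew that])
  qed

  note int = L2_mult_integrable[OF L2_saturation[OF W12_L2[OF w]] D]
  \<comment> \<open>The integrand is a nonnegative function times one of strict sign and has integral zero.\<close>
  from assms(8) have "AE x in lebesgue_on \<Omega>. w x = 0"
  proof
    assume pos: "AE x in lebesgue_on \<Omega>. ?D x > 0"
    then have "AE x in lebesgue_on \<Omega>. 0 \<le> saturation (w x) * ?D x"
      by eventually_elim (simp add: saturation_bounds)
    then have "AE x in lebesgue_on \<Omega>. saturation (w x) * ?D x = 0"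
      using integral_nonneg_eq_0_iff_AE[OF int] zero by simp
    with pos show ?thesis by eventually_elim (simp add: saturation_eq_0_iff)
  next
    assume neg: "AE x in lebesgue_on \<Omega>. ?D x < 0"
    then have "AE x in lebesgue_on \<Omega>. 0 \<le> - (saturation (w x) * ?D x)"
      by eventually_elim (simp add: saturation_bounds mult_nonneg_nonpos)
    then have "AE x in lebesgue_on \<Omega>. - (saturation (w x) * ?D x) = 0"
      using integral_nonneg_eq_0_iff_AE[OF integrable_minus[OF int]] zero by simp
    with neg show ?thesis by eventually_elim (simp add: saturation_eq_0_iff)
  qed
  then show ?thesis by eventually_elim (simp add: w_def)
qed

end
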